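(* Let $d\ge3$ and $a>b>0$. For all $\beta>0$ and $\mu\in\mathbb R$, $$P^{\mathrm{HYL}}(\beta,\mu)<\widetilde P^{\mathrm{HYL}}(\beta,\mu).$$
   Context: **Loops and the free loop soup.** $\Gamma_{\mathrm F}=\bigcup_{j\ge1}\{\omega:[0,\beta j]\to\mathbb R^d\text{ continuous},\ \omega(0)=\omega(\beta j)\}$; for $\omega:[0,\beta j]\to\mathbb R^d$ write $\ell(\omega)=j$. Let $\mathbb P^t_{x,x}=(2\pi t)^{-d/2}\,\mathbb B^t_{x,x}$, where $\mathbb B^t_{x,x}$ is the law of the standard Brownian bridge in $\mathbb R^d$ from $x$ to $x$ with time horizon $t$. For Borel $\Lambda\subset\mathbb R^d$, $\mathbb P_{\Lambda,\beta,0}$ (expectation $\mathbb E_{\Lambda,\beta,0}$) is the law of the Poisson point process $\eta$ on $\Gamma_{\mathrm F}$ with intensity measure $\int_\Lambda dx\sum_{j\ge1}\frac1j\mathbb P^{\beta j}_{x,x}$. Let $N_\Lambda(\eta)=\sum_{\omega\in\eta:\,\omega(0)\in\Lambda}\ell(\omega)$. **Scales.** $\Lambda=[-n/2,n/2)^d$, $|\Lambda|=n^d$, and $\lim_{\Lambda\to\mathbb R^d}$ means $n\to\infty$. Let $a_\Lambda=|\Lambda|^{2/3}$ if $d=3$, $|\Lambda|^{1/2}(\log|\Lambda|)^{1/2}$ if $d=4$, $|\Lambda|^{1/2}$ if $d\ge5$. The cut-off $q_\Lambda\in\mathbb N$ is a fixed sequence with $q_\Lambda=o(|\Lambda|)$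 and $a_\Lambda=o(q_\Lambda)$ as $n\to\infty$ (in particular $q_\Lambda\to\infty$). **Hamiltonians.** With $n_k(\eta)=\#\{\omega\in\eta:\omega(0)\in\Lambda,\ \ell(\omega)=k\}$, $$\mathsf H_\Lambda=\frac{a}{2|\Lambda|}N_\Lambda^2-\frac{b}{2|\Lambda|}\sum_{k\ge q_\Lambda}k^2n_k^2,\qquad \widetilde{\mathsf H}_\Lambda=\frac{a}{2|\Lambda|}N_\Lambda^2-\frac{b}{2|\Lambda|}\sum_{k\ge1}k^2n_k^2 .$$ **Pressures.** $$P^{\mathrm{HYL}}(\beta,\mu)=\lim_{\Lambda\to\mathbb R^d}\frac1{\beta|\Lambda|}\log\mathbb E_{\Lambda,\beta,0}\big[e^{\beta\mu N_\Lambda-\beta\mathsf H_\Lambda}\big],\qquad \widetilde P^{\mathrm{HYL}}(\beta,\mu)=\lim_{\Lambda\to\mathbb R^d}\frac1{\beta|\Lambda|}\log\mathbb E_{\Lambda,\beta,0}\big[e^{\beta\mu N_\Lambda-\beta\widetilde{\mathsf H}_\Lambda}\big].$$ Both limits are known to exist (and are finite). *)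

theory Defs
  imports "HOL-Probability.Probability" "HOL-Library.Landau_Symbols" "HOL-Library.Multiset"
begin

text \<open>
  A path on $[0,t]$ is a function that is \<open>undefined\<close> outside $[0,t]$; the trace of the product
  \<open>\<sigma>\<close>-algebra on the continuous loops is the Borel \<open>\<sigma>\<close>-algebra of uniform convergence. Only the
  space and the \<open>\<sigma>\<close>-algebra of \<open>loops t\<close> matter.
\<close>

definition loops :: "real \<Rightarrow> (real \<Rightarrow> real^'d::finite) measure" where
  "loops t = restrict_space (\<Pi>\<^sub>M s\<in>{0..t}. borel) {\<omega>. continuous_on {0..t} \<omega> \<and> \<omega> 0 = \<omega> t}"

text \<open>
  The standard Brownian bridge from \<open>0\<close> to \<open>0\<close> with time horizon \<open>t\<close>: the continuous centred
  Gaussian process with covariance $E[\omega_i(s)\omega_j(u)] = \delta_{ij}(\min(s,u) - su/t)$,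
  given by the characteristic functions of its finite-dimensional distributions.
\<close>

definition standard_brownian_bridge :: "real \<Rightarrow> (real \<Rightarrow> real^'d::finite) measure \<Rightarrow> bool" where
  "standard_brownian_bridge t M \<longleftrightarrow>
     prob_space M \<and> space M = space (loops t) \<and> sets M = sets (loops t) \<and>
     (\<forall>S c. finite S \<and> S \<subseteq> {0..t} \<longrightarrow>
        (CLINT \<omega>|M. iexp (\<Sum>s\<in>S. c s \<bullet> \<omega> s)) =
        complex_of_real (exp (- (\<Sum>s\<in>S. \<Sum>u\<in>S. (c s \<bullet> c u) * (min s u - s * u / t)) / 2)))"

text \<open>\<open>B\<close> stands for the family of the laws of the standard Brownian bridges from \<open>0\<close> to \<open>0\<close>, indexed
  by the time horizon; \<open>bridge_law B t x\<close> is the law of the bridge from \<open>x\<close> to \<open>x\<close>.\<close>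

definition bridge_law ::
  "(real \<Rightarrow> (real \<Rightarrow> real^'d::finite) measure) \<Rightarrow> real \<Rightarrow> real^'d \<Rightarrow> (real \<Rightarrow> real^'d) measure" where
  "bridge_law B t x = distr (B t) (loops t) (\<lambda>\<omega>. \<lambda>s\<in>{0..t}. x + \<omega> s)"

definition unnormalised_bridge ::
  "(real \<Rightarrow> (real \<Rightarrow> real^'d::finite) measure) \<Rightarrow> real \<Rightarrow> real^'d \<Rightarrow> (real \<Rightarrow> real^'d) measure" where
  "unnormalised_bridge B t x =
     scale_measure (ennreal ((2 * pi * t) powr (- real CARD('d) / 2))) (bridge_law B t x)"

text \<open>A loop \<open>\<omega> : [0, \<beta>j] \<rightarrow> R\<^sup>d\<close> is stored as the pair \<open>(j, \<omega>)\<close>, since a HOL function does not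
  determine its domain.\<close>

type_synonym 'd loop = "nat \<times> (real \<Rightarrow> real^'d)"

definition loop_length :: "'d::finite loop \<Rightarrow> nat" where
  "loop_length = fst"

definition loop_start :: "'d::finite loop \<Rightarrow> real^'d" where
  "loop_start w = snd w 0"

definition Gamma_F :: "real \<Rightarrow> 'd::finite loop set" where
  "Gamma_F \<beta> = (SIGMA j:{1..}. space (loops (\<beta> * real j)))"

definition loop_intensity ::
  "(real \<Rightarrow> (real \<Rightarrow> real^'d::finite) measure) \<Rightarrow> real \<Rightarrow> (real^'d) set \<Rightarrow> 'd loop measure" where
  "loop_intensity B \<beta> \<Lambda> =
     measure_of (Gamma_F \<beta>) {{j} \<times> A | j A. 1 \<le> j \<and> A \<in> sets (loops (\<beta> * real j))}
       (\<lambda>A. \<integral>\<^sup>+x\<in>\<Lambda>. (\<Sum>i. let j = Suc i in ennreal (1 / real j) *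
               emeasure (unnormalised_bridge B (\<beta> * real j) x) {\<omega>. (j, \<omega>) \<in> A}) \<partial>lborel)"

text \<open>Point configurations are finite multisets, which is enough for finite intensities.\<close>

definition count_points :: "'x set \<Rightarrow> 'x multiset \<Rightarrow> nat" where
  "count_points A \<eta> = size (filter_mset (\<lambda>x. x \<in> A) \<eta>)"

definition configurations :: "'x measure \<Rightarrow> 'x multiset measure" where
  "configurations X =
     sigma {\<eta>. set_mset \<eta> \<subseteq> space X}
       {{\<eta>. set_mset \<eta> \<subseteq> space X \<and> count_points A \<eta> = k} | A k. A \<in> sets X}"

text \<open>The Poisson weights are written out because
  \<open>poisson_pmf\<close> excludes the rate \<open>0\<close>.\<close>

definition poisson_point_process :: "'x measure \<Rightarrow> 'x multiset measure \<Rightarrow> bool" where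
  "poisson_point_process \<nu> P \<longleftrightarrow>
     prob_space P \<and> space P = space (configurations \<nu>) \<and> sets P = sets (configurations \<nu>) \<and>
     (\<forall>A\<in>sets \<nu>. emeasure \<nu> A < \<infinity> \<longrightarrow>
        (\<forall>k. measure P {\<eta>\<in>space P. count_points A \<eta> = k} =
             measure \<nu> A ^ k / fact k * exp (- measure \<nu> A))) \<and>
     (\<forall>(I :: nat set) A. finite I \<and> disjoint_family_on A I \<and> A ` I \<subseteq> sets \<nu> \<longrightarrow>
        prob_space.indep_vars P (\<lambda>_. count_space UNIV) (\<lambda>i. count_points (A i)) I)"

definition cube :: "nat \<Rightarrow> (real^'d::finite) set" where
  "cube n = {x. \<forall>i. - (real n / 2) \<le> x $ i \<and> x $ i < real n / 2}"

text \<open>The scale as a function of the dimension and the volume, for dimension at least \<open>3\<close>.\<close>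

definition scale :: "nat \<Rightarrow> real \<Rightarrow> real" where
  "scale d v = (if d = 3 then v powr (2/3)
                else if d = 4 then v powr (1/2) * ln v powr (1/2)
                else v powr (1/2))"

definition admissible_cutoff :: "'d::finite itself \<Rightarrow> (nat \<Rightarrow> nat) \<Rightarrow> bool" where
  "admissible_cutoff T q \<longleftrightarrow>
     (\<lambda>n. real (q n)) \<in> o(\<lambda>n. measure lborel (cube n :: (real^'d) set)) \<and>
     (\<lambda>n. scale CARD('d) (measure lborel (cube n :: (real^'d) set))) \<in> o(\<lambda>n. real (q n))"

definition particle_number :: "(real^'d::finite) set \<Rightarrow> 'd loop multiset \<Rightarrow> nat" where
  "particle_number \<Lambda> \<eta> = (\<Sum>w\<in>#filter_mset (\<lambda>w. loop_start w \<in> \<Lambda>) \<eta>. loop_length w)"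

definition cycle_count :: "(real^'d::finite) set \<Rightarrow> nat \<Rightarrow> 'd loop multiset \<Rightarrow> nat" where
  "cycle_count \<Lambda> k \<eta> = size (filter_mset (\<lambda>w. loop_start w \<in> \<Lambda> \<and> loop_length w = k) \<eta>)"

text \<open>The Hamiltonian whose negative part runs over cycle lengths \<open>k \<ge> q\<close>; for each configuration
  only finitely many summands are nonzero.\<close>

definition hamiltonian ::
  "real \<Rightarrow> real \<Rightarrow> nat \<Rightarrow> (real^'d::finite) set \<Rightarrow> 'd loop multiset \<Rightarrow> real" where
  "hamiltonian a b q \<Lambda> \<eta> =
     a / (2 * measure lborel \<Lambda>) * (real (particle_number \<Lambda> \<eta>))\<^sup>2
     - b / (2 * measure lborel \<Lambda>) *
         (\<Sum>\<^sub>\<infinity>k\<in>{q..}. (real k)\<^sup>2 * (real (cycle_count \<Lambda> k \<eta>))\<^sup>2)"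

text \<open>\<open>P n\<close> stands for the law of the free loop soup in \<open>cube n\<close> at inverse temperature \<open>\<beta>\<close>.\<close>

definition finite_volume_pressure ::
  "(nat \<Rightarrow> 'd::finite loop multiset measure) \<Rightarrow> real \<Rightarrow> real \<Rightarrow> (nat \<Rightarrow> nat) \<Rightarrow> real \<Rightarrow> real \<Rightarrow> nat \<Rightarrow> real"
  where
  "finite_volume_pressure P a b q \<beta> \<mu> n =
     1 / (\<beta> * measure lborel (cube n :: (real^'d) set)) *
     ln (\<integral>\<eta>. exp (\<beta> * \<mu> * real (particle_number (cube n) \<eta>)
                   - \<beta> * hamiltonian a b (q n) (cube n) \<eta>) \<partial>P n)"

definition pressure_HYL ::
  "(nat \<Rightarrow> 'd::finite loop multiset measure) \<Rightarrow> real \<Rightarrow> real \<Rightarrow> (nat \<Rightarrow> nat) \<Rightarrow> real \<Rightarrow> real \<Rightarrow> real" where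
  "pressure_HYL P a b q \<beta> \<mu> = lim (finite_volume_pressure P a b q \<beta> \<mu>)"

definition pressure_HYL_full ::
  "(nat \<Rightarrow> 'd::finite loop multiset measure) \<Rightarrow> real \<Rightarrow> real \<Rightarrow> real \<Rightarrow> real \<Rightarrow> real" where
  "pressure_HYL_full P a b \<beta> \<mu> = lim (finite_volume_pressure P a b (\<lambda>_. 1) \<beta> \<mu>)"

end

(*
  Conditionally on the other cycle counts, the number X of loops of length 1 is Poisson with mean of
  order |Lambda|, and X contributes to the negative part of the Hamiltonian with the full sum but not
  with the cut-off sum. Let Q be the soup tilted by the Boltzmann weight of the cut-off model. Since
  a > b, that weight decays like a Gaussian in N/|Lambda|^(1/2), so N is at most K |Lambda| with
  Q-probability at least 1/2 (compare with the probability of the empty configuration). The Mecke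
  equation for X then gives E_Q[X] >= s |Lambda| with s > 0 independent of Lambda, and by Jensen's
  inequality E_Q[exp(beta b X^2 / (2|Lambda|))], a lower bound for the quotient of the partition
  functions, is at least exp(beta b s^2 |Lambda| / 2).
*)

theory Submission
  imports Defs
begin

text \<open>Enlarging the negative sum raises every Boltzmann weight, but this alone gives only a
  weak inequality of the limits. Strictness needs a gain exponential in the volume, at a rate that
  does not depend on \<open>n\<close>. Loops of length 1 supply it: the cut-off eventually exceeds
  1, their number has mean of order \<open>V\<close>, and it is independent of all longer loops.
  Their abundance in the free soup is not enough, because the quotient of the partition functions is
  an expectation under the tilted law, which might suppress them. Adding one such loop changes the
  cut-off weight only through \<open>n\<close> in the terms with \<mu> and \<open>a\<close>, and the
  cost is about \<beta> \<open>a n / V\<close>. It is bounded only where \<open>n\<close> is of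
  order \<open>V\<close>, so large \<open>n\<close> must be discarded before the Mecke equation is
  of use. The condition \<open>b < a\<close> enters through the bound of a sum of squares by the
  square of the sum: the negative part is at most \<open>b / (2 * V)\<close> times the squared
  particle number.\<close>

section \<open>A Poisson variable with an independent environment, and its tilted law\<close>

text \<open>Mecke equation in one variable, resting on \<open>k * p k = L * p (k - 1)\<close> for
  the Poisson weights. Nonnegative integrals spare any integrability assumption on
  \<open>g\<close>.\<close>

lemma (in prob_space) nn_integral_poisson_shift:
  fixes X :: "'a \<Rightarrow> nat" and g :: "nat \<Rightarrow> 'b \<Rightarrow> ennreal"
  assumes X[measurable]: "X \<in> measurable M (count_space UNIV)" and Y[measurable]: "Y \<in> measurable M N"
    and indep: "distr M (count_space UNIV) X \<Otimes>\<^sub>M distr M N Y = distr M (count_space UNIV \<Otimes>\<^sub>M N) (\<lambda>x. (X x, Y x))"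
    and poisson: "\<And>k. prob {x\<in>space M. X x = k} = L ^ k / fact k * exp (- L)"
    and "0 \<le> L"
    and g: "case_prod g \<in> borel_measurable (count_space UNIV \<Otimes>\<^sub>M N)"
  shows "(\<integral>\<^sup>+x. of_nat (X x) * g (X x) (Y x) \<partial>M) = ennreal L * (\<integral>\<^sup>+x. g (Suc (X x)) (Y x) \<partial>M)"
proof -
  let ?C = "count_space (UNIV :: nat set)"
  define p where "p k = L ^ k / fact k * exp (- L)" for k
  have p_nonneg: "0 \<le> p k" for k
    using \<open>0 \<le> L\<close> by (simp add: p_def)
  interpret DX: prob_space "distr M ?C X" by (rule prob_space_distr) simp
  interpret DY: prob_space "distr M N Y" by (rule prob_space_distr) simp
  interpret DD: pair_sigma_finite "distr M ?C X" "distr M N Y" ..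
  have dX: "distr M ?C X = density ?C (\<lambda>k. ennreal (p k))"
  proof (rule measure_eqI_countable)
    fix k
    have "emeasure (distr M ?C X) {k} = emeasure M {x\<in>space M. X x = k}"
      by (subst emeasure_distr) (auto intro!: arg_cong[where f="emeasure M"])
    also have "\<dots> = ennreal (p k)"
      by (simp add: emeasure_eq_measure poisson p_def)
    also have "\<dots> = emeasure (density ?C (\<lambda>k. ennreal (p k))) {k}"
      by (subst emeasure_density) (auto simp: nn_integral_indicator_singleton)
    finally show "emeasure (distr M ?C X) {k} = emeasure (density ?C (\<lambda>k. ennreal (p k))) {k}" .
  qed (auto simp: countableI_type)
  \<comment> \<open>The joint law is a product, so the Poisson variable can be summed out while the
    environment \<open>y\<close> is frozen.\<close>
  have disint: "(\<integral>\<^sup>+x. h (X x) (Y x) \<partial>M) = (\<integral>\<^sup>+y. (\<Sum>k. ennreal (p k) * h k y) \<partial>distr M N Y)"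
    if h: "case_prod h \<in> borel_measurable (?C \<Otimes>\<^sub>M N)" for h :: "nat \<Rightarrow> 'b \<Rightarrow> ennreal"
  proof -
    have "(\<integral>\<^sup>+x. h (X x) (Y x) \<partial>M) = (\<integral>\<^sup>+z. case_prod h z \<partial>distr M (?C \<Otimes>\<^sub>M N) (\<lambda>x. (X x, Y x)))"
      using h by (subst nn_integral_distr) auto
    also have "\<dots> = (\<integral>\<^sup>+z. case_prod h z \<partial>(distr M ?C X \<Otimes>\<^sub>M distr M N Y))"
      using indep by simp
    also have "\<dots> = (\<integral>\<^sup>+y. (\<integral>\<^sup>+k. h k y \<partial>distr M ?C X) \<partial>distr M N Y)"
      using DD.nn_integral_snd[of "case_prod h"] h
      by (simp add: measurable_cong_sets[OF sets_pair_measure_cong[OF sets_distr sets_distr] refl])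
    also have "\<dots> = (\<integral>\<^sup>+y. (\<Sum>k. ennreal (p k) * h k y) \<partial>distr M N Y)"
      by (simp add: dX nn_integral_density nn_integral_count_space_nat)
    finally show ?thesis .
  qed
  have p_Suc: "ennreal (p (Suc k)) * of_nat (Suc k) = ennreal L * ennreal (p k)" for k
  proof -
    have "p (Suc k) * real (Suc k) = L * p k"
      by (simp add: p_def del: of_nat_Suc)
    then show ?thesis
      using p_nonneg[of k] p_nonneg[of "Suc k"] \<open>0 \<le> L\<close>
      by (simp only: ennreal_of_nat_eq_real_of_nat of_nat_0_le_iff flip: ennreal_mult)
  qed
  have shift: "(\<Sum>k. ennreal (p k) * (of_nat k * g k y)) = ennreal L * (\<Sum>k. ennreal (p k) * g (Suc k) y)" for y
  proof -
    \<comment> \<open>The factor \<open>k\<close> kills the term at 0, so the sum may start at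
      1.\<close>
    have "(\<Sum>k. ennreal (p k) * (of_nat k * g k y)) = (\<Sum>k. ennreal (p (Suc k)) * (of_nat (Suc k) * g (Suc k) y))"
      using suminf_offset[of "\<lambda>k. ennreal (p k) * (of_nat k * g k y)" 1] by simp
    also have "\<dots> = (\<Sum>k. ennreal L * (ennreal (p k) * g (Suc k) y))"
      by (simp only: p_Suc mult.assoc flip: mult.assoc[of "ennreal (p (Suc _))"])
    finally show ?thesis by simp
  qed
  have g': "(\<lambda>(k, y). g (f k) y) \<in> borel_measurable (?C \<Otimes>\<^sub>M N)" for f
  proof -
    have "(\<lambda>z. case_prod g (f (fst z), snd z)) \<in> borel_measurable (?C \<Otimes>\<^sub>M N)"
      by (rule measurable_compose[OF _ g]) simp
    then show ?thesis by (simp add: split_beta)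
  qed
  have m1: "(\<lambda>(k, y). of_nat k * g k y) \<in> borel_measurable (?C \<Otimes>\<^sub>M N)"
  proof -
    have "(\<lambda>z. of_nat (fst z) * case_prod g z) \<in> borel_measurable (?C \<Otimes>\<^sub>M N)"
      using g by measurable
    then show ?thesis by (simp add: split_beta)
  qed
  have m2: "(\<lambda>y. \<Sum>k. ennreal (p k) * g (Suc k) y) \<in> borel_measurable (distr M N Y)"
  proof -
    have [measurable]: "(\<lambda>y. g (Suc k) y) \<in> borel_measurable N" for k
      using measurable_Pair2[OF g'[of Suc], of k] by simp
    show ?thesis by measurable
  qed
  show ?thesis
    using m2 by (simp add: disint[OF m1] disint[OF g'] shift nn_integral_cmult)
qed

text \<open>The loop soup reduced to four numbers: \<open>X\<close> counts the loops of length 1,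
  \<open>Y\<close> the particles in longer loops, \<open>S\<close> is the cut-off sum of squares and
  \<open>T\<close> the full one. \<open>Y\<close> and \<open>S\<close> may depend on each other;
  only the pair is independent of \<open>X\<close>. In \<open>s\<close>, \<rho> bounds the density
  of unit loops from below, the exponential bounds the change of weight when one is added, and the
  factor 1/2 pays for discarding large particle numbers.\<close>

lemma (in prob_space) tilted_gap:
  fixes X :: "'a \<Rightarrow> nat" and Y S T :: "'a \<Rightarrow> real"
  assumes X[measurable]: "X \<in> measurable M (count_space UNIV)"
    and Y[measurable]: "Y \<in> borel_measurable M" and S[measurable]: "S \<in> borel_measurable M"
    and indep: "distr M (count_space UNIV) X \<Otimes>\<^sub>M distr M (borel \<Otimes>\<^sub>M borel) (\<lambda>x. (Y x, S x)) =
      distr M (count_space UNIV \<Otimes>\<^sub>M (borel \<Otimes>\<^sub>M borel)) (\<lambda>x. (X x, Y x, S x))"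
    and poisson: "\<And>k. prob {x\<in>space M. X x = k} = L ^ k / fact k * exp (- L)"
    and T[measurable]: "T \<in> borel_measurable M"
    and nonneg: "\<And>x. x \<in> space M \<Longrightarrow> 0 \<le> Y x" "\<And>x. x \<in> space M \<Longrightarrow> 0 \<le> S x"
    and lower: "\<And>x. x \<in> space M \<Longrightarrow> (real (X x))\<^sup>2 + S x \<le> T x"
    and upper: "\<And>x. x \<in> space M \<Longrightarrow> T x \<le> (real (X x) + Y x)\<^sup>2"
    and empty: "exp (- c * V) \<le> prob {x\<in>space M. real (X x) + Y x = 0}"
    and V: "1 \<le> V" and L: "\<rho> * V \<le> L" "0 < \<rho>" and ab: "b < a" "0 < b" and \<beta>: "0 < \<beta>" and "0 \<le> c"
    and K: "1 \<le> K" "\<beta> * \<bar>\<mu>\<bar> + c + 1 \<le> \<beta> * (a - b) / 2 * K"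
    and s: "s = \<rho> / 2 * exp (\<beta> * \<mu> - \<beta> * a * (K + 1))"
  shows "ln (\<integral>x. exp (\<beta> * \<mu> * (real (X x) + Y x) - \<beta> * (a / (2 * V) * (real (X x) + Y x)\<^sup>2 - b / (2 * V) * S x)) \<partial>M)
           + \<beta> * b * s\<^sup>2 / 2 * V
         \<le> ln (\<integral>x. exp (\<beta> * \<mu> * (real (X x) + Y x) - \<beta> * (a / (2 * V) * (real (X x) + Y x)\<^sup>2 - b / (2 * V) * T x)) \<partial>M)"
proof -
  \<comment> \<open>The chemical potential \<open>m\<close> stays a parameter because a shifted
    value of it serves to absorb the factor \<open>X\<close> below.\<close>
  define E where "E m n r = \<beta> * m * n - \<beta> * (a / (2 * V) * n\<^sup>2 - b / (2 * V) * r)" for m n r :: real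
  define n where "n x = real (X x) + Y x" for x
  define W where "W x = exp (E \<mu> (n x) (S x))" for x
  define W' where "W' x = exp (E \<mu> (n x) (T x))" for x
  define Z where "Z = (\<integral>x. W x \<partial>M)"
  define Z' where "Z' = (\<integral>x. W' x \<partial>M)"
  have [measurable]: "n \<in> borel_measurable M" "W \<in> borel_measurable M" "W' \<in> borel_measurable M"
    unfolding n_def W_def W'_def E_def by measurable
  have Sn: "S x \<le> (n x)\<^sup>2" and Tn: "T x \<le> (n x)\<^sup>2" if "x \<in> space M" for x
    using lower[OF that] upper[OF that] by (auto simp: n_def intro: order_trans[rotated] add_increasing)
  have E_mono: "E m k r \<le> E m k r'" if "r \<le> r'" for m k r r'
    using that ab \<beta> V by (auto simp: E_def intro!: mult_left_mono divide_right_mono)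
  \<comment> \<open>Rate of the Gaussian decay left over when the negative part is as large as
    possible, \<open>r = k^2\<close>. Completing the square then bounds the exponent
    uniformly.\<close>
  define D where "D = \<beta> * (a - b) / (2 * V)"
  have D: "0 < D" using ab \<beta> V by (auto simp: D_def)
  have E_le: "E m k r \<le> \<beta> * m * k - D * k\<^sup>2" if "r \<le> k\<^sup>2" for m k r
    using E_mono[OF that, of m k] V by (simp add: E_def D_def field_simps)
  have E_bound: "E m k r \<le> (\<beta> * m)\<^sup>2 / (4 * D)" if "r \<le> k\<^sup>2" for m k r
  proof -
    have "0 \<le> (2 * D * k - \<beta> * m)\<^sup>2 / (4 * D)" using D by simp
    also have "\<dots> = D * k\<^sup>2 - \<beta> * m * k + (\<beta> * m)\<^sup>2 / (4 * D)"
      using D by (simp add: field_simps power2_eq_square)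
    finally show ?thesis using E_le[OF that, of m] by linarith
  qed
  have W_nonneg[simp]: "0 \<le> W x" for x by (simp add: W_def)
  have intW[simp, intro]: "integrable M W"
  proof (rule integrable_const_bound)
    show "AE x in M. norm (W x) \<le> exp ((\<beta> * \<mu>)\<^sup>2 / (4 * D))"
      using E_bound[OF Sn, of _ \<mu>] by (intro AE_I2) (simp add: W_def)
  qed simp
  have intW'[simp, intro]: "integrable M W'"
  proof (rule integrable_const_bound)
    show "AE x in M. norm (W' x) \<le> exp ((\<beta> * \<mu>)\<^sup>2 / (4 * D))"
      using E_bound[OF Tn, of _ \<mu>] by (intro AE_I2) (simp add: W'_def)
  qed simp
  \<comment> \<open>The bound \<open>X \<le> n \<le> exp n\<close> turns the factor \<open>X\<close>
    into a shift of \<mu> by 1/\<beta>, and the Gaussian bound applies again.\<close>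
  have intXW[simp, intro]: "integrable M (\<lambda>x. real (X x) * W x)"
  proof (rule integrable_const_bound)
    show "AE x in M. norm (real (X x) * W x) \<le> exp ((\<beta> * (\<mu> + 1 / \<beta>))\<^sup>2 / (4 * D))"
    proof (rule AE_I2)
      fix x assume x: "x \<in> space M"
      have "real (X x) \<le> n x" using nonneg(1)[OF x] by (simp add: n_def)
      also have "n x \<le> exp (n x)" using exp_ge_add_one_self[of "n x"] by linarith
      finally have "norm (real (X x) * W x) \<le> exp (n x) * W x" by (simp add: W_def)
      also have "\<dots> = exp (E (\<mu> + 1 / \<beta>) (n x) (S x))"
        using \<beta> by (simp add: W_def E_def distrib_left distrib_right flip: exp_add)
      also have "\<dots> \<le> exp ((\<beta> * (\<mu> + 1 / \<beta>))\<^sup>2 / (4 * D))" using E_bound[OF Sn[OF x]] by simp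
      finally show "norm (real (X x) * W x) \<le> exp ((\<beta> * (\<mu> + 1 / \<beta>))\<^sup>2 / (4 * D))" .
    qed
  qed simp
  \<comment> \<open>Where \<open>n\<close> vanishes, the weight is at least 1, since
    \<open>S\<close> only raises it.\<close>
  have Z_ge: "exp (- c * V) \<le> Z"
  proof -
    have "exp (- c * V) \<le> (\<integral>x. indicator {x\<in>space M. n x = 0} x \<partial>M)"
      using empty by (simp add: n_def)
    also have "\<dots> \<le> Z"
      unfolding Z_def
    proof (rule integral_mono)
      fix x assume x: "x \<in> space M"
      have "1 \<le> W x" if "n x = 0"
        using that nonneg(2)[OF x] ab V \<beta> by (simp add: W_def E_def)
      then show "indicator {x\<in>space M. n x = 0} x \<le> W x"
        by (auto simp: indicator_def W_def)
    qed (auto intro!: integrable_real_indicator simp: emeasure_eq_measure)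
    finally show ?thesis .
  qed
  then have Z_pos: "0 < Z" using exp_gt_zero[of "- c * V"] by linarith
  define A where "A = {x\<in>space M. n x \<le> K * V}"
  have A[measurable]: "A \<in> events" by (simp add: A_def)
  \<comment> \<open>\<open>K\<close> is chosen so that outside \<open>A\<close> the exponent is at
    most \<open>- (c + 1) * V\<close>. Compared with \<open>exp (- c * V) \<le> Z\<close> this
    leaves a factor \<open>exp (- V)\<close>, which is at most 1/2 because \<open>V\<close> is at
    least 1.\<close>
  have tail: "Z \<le> 2 * (\<integral>x. W x * indicator A x \<partial>M)"
  proof -
    have "Z \<le> (\<integral>x. W x * indicator A x + exp (- (c + 1) * V) \<partial>M)"
      unfolding Z_def
    proof (rule integral_mono)
      fix x assume x: "x \<in> space M"
      have "W x \<le> exp (- (c + 1) * V)" if "x \<notin> A"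
      proof -
        have nK: "K * V < n x" using that x by (auto simp: A_def)
        have "1 * V \<le> K * V" using K V by (intro mult_right_mono) auto
        then have nV: "V \<le> n x" "0 < n x" using nK V by linarith+
        have "\<beta> * (a - b) / 2 * K \<le> D * n x"
        proof -
          have "\<beta> * (a - b) / 2 * K = D * (K * V)" using V by (simp add: D_def)
          also have "\<dots> \<le> D * n x" using D nK by simp
          finally show ?thesis .
        qed
        moreover have "\<beta> * \<mu> \<le> \<beta> * \<bar>\<mu>\<bar>" using \<beta> by simp
        ultimately have *: "\<beta> * \<mu> - D * n x \<le> - (c + 1)" using K(2) by linarith
        have "E \<mu> (n x) (S x) \<le> \<beta> * \<mu> * n x - D * (n x)\<^sup>2" by (rule E_le[OF Sn[OF x]])
        also have "\<dots> = (\<beta> * \<mu> - D * n x) * n x" by (simp add: algebra_simps power2_eq_square)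
        also have "\<dots> \<le> - (c + 1) * n x" using * nV by (intro mult_right_mono) auto
        also have "\<dots> \<le> - (c + 1) * V" using nV \<open>0 \<le> c\<close> by (intro mult_left_mono_neg) auto
        finally show ?thesis by (simp add: W_def)
      qed
      then show "W x \<le> W x * indicator A x + exp (- (c + 1) * V)"
        by (cases "x \<in> A") auto
    qed (auto intro!: integrable_real_mult_indicator)
    also have "\<dots> = (\<integral>x. W x * indicator A x \<partial>M) + exp (- (c + 1) * V)"
      by (subst Bochner_Integration.integral_add) (auto intro!: integrable_real_mult_indicator simp: prob_space)
    also have "exp (- (c + 1) * V) = exp (- V) * exp (- c * V)"
      by (simp add: algebra_simps flip: exp_add)
    also have "\<dots> \<le> 1 / 2 * Z"
    proof (rule mult_mono)
      have "2 \<le> exp V" using exp_ge_add_one_self[of V] V by linarith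
      then show "exp (- V) \<le> 1 / 2" by (simp add: exp_minus field_simps)
    qed (use Z_ge in auto)
    finally show ?thesis by simp
  qed
  have L_pos: "0 < L" using L V by (smt (verit) mult_pos_pos)
  define F where "F m y = exp (E \<mu> (real m + fst y) (snd y))" for m :: nat and y :: "real \<times> real"
  have F_W: "F (X x) (Y x, S x) = W x" for x by (simp add: F_def W_def n_def)
  \<comment> \<open>Weight after adding one loop of length 1. \<open>Y\<close> and \<open>S\<close>
    stay fixed because such a loop lies below the cut-off.\<close>
  define G where "G x = F (Suc (X x)) (Y x, S x)" for x
  \<comment> \<open>One more particle raises \<open>n^2\<close> by \<open>2 * n + 1\<close>, and on
    \<open>A\<close> the quotient \<open>(2 * n + 1) / (2 * V)\<close> is at most
    \<open>K + 1\<close>.\<close>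
  define \<delta> where "\<delta> = exp (\<beta> * \<mu> - \<beta> * a * (K + 1))"
  have G_ge: "\<delta> * (W x * indicator A x) \<le> G x" if x: "x \<in> space M" for x
  proof (cases "x \<in> A")
    case True
    then have "n x \<le> K * V" by (simp add: A_def)
    then have "(2 * n x + 1) / (2 * V) \<le> K + 1" using V by (simp add: field_simps)
    then have "\<beta> * a * ((2 * n x + 1) / (2 * V)) \<le> \<beta> * a * (K + 1)"
      using \<beta> ab by (intro mult_left_mono) auto
    moreover have "E \<mu> (1 + n x) (S x) = E \<mu> (n x) (S x) + \<beta> * \<mu> - \<beta> * a * ((2 * n x + 1) / (2 * V))"
      using V by (simp add: E_def field_simps power2_eq_square)
    ultimately have "\<beta> * \<mu> - \<beta> * a * (K + 1) + E \<mu> (n x) (S x) \<le> E \<mu> (1 + n x) (S x)" by linarith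
    then show ?thesis using True by (simp add: \<delta>_def W_def G_def F_def n_def add.assoc flip: exp_add)
  next
    case False then show ?thesis by (simp add: G_def F_def)
  qed
  \<comment> \<open>The Mecke equation turns the factor \<open>X\<close> into one additional loop of length 1.\<close>
  have XW: "s * V * Z \<le> (\<integral>x. real (X x) * W x \<partial>M)"
  proof -
    have F_meas: "(\<lambda>(m, y). ennreal (F m y)) \<in> borel_measurable (count_space UNIV \<Otimes>\<^sub>M (borel \<Otimes>\<^sub>M borel))"
      unfolding F_def E_def by measurable
    have "ennreal (L * (\<delta> * (\<integral>x. W x * indicator A x \<partial>M))) = ennreal L * ennreal (\<integral>x. \<delta> * (W x * indicator A x) \<partial>M)"
      using L_pos by (simp add: ennreal_mult' \<delta>_def)
    also have "\<dots> = ennreal L * (\<integral>\<^sup>+x. ennreal (\<delta> * (W x * indicator A x)) \<partial>M)"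
      by (subst nn_integral_eq_integral)
        (auto intro!: integrable_real_mult_indicator integrable_mult_right simp: \<delta>_def)
    also have "\<dots> \<le> ennreal L * (\<integral>\<^sup>+x. ennreal (G x) \<partial>M)"
      by (intro mult_left_mono nn_integral_mono ennreal_leI G_ge) auto
    also have "\<dots> = (\<integral>\<^sup>+x. of_nat (X x) * ennreal (W x) \<partial>M)"
      using nn_integral_poisson_shift[OF X _ indep poisson _ F_meas] L_pos by (simp add: G_def F_W)
    also have "\<dots> = (\<integral>\<^sup>+x. ennreal (real (X x) * W x) \<partial>M)"
      by (simp add: ennreal_mult' ennreal_of_nat_eq_real_of_nat)
    also have "\<dots> = ennreal (\<integral>x. real (X x) * W x \<partial>M)"
      by (rule nn_integral_eq_integral) auto
    finally have *: "L * (\<delta> * (\<integral>x. W x * indicator A x \<partial>M)) \<le> (\<integral>x. real (X x) * W x \<partial>M)"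
      by (subst (asm) ennreal_le_iff) (auto intro!: integral_nonneg)
    have "s * V * Z = (\<rho> * V) * (\<delta> * (Z / 2))" by (simp add: s \<delta>_def)
    also have "\<dots> \<le> L * (\<delta> * (\<integral>x. W x * indicator A x \<partial>M))"
      using L V tail Z_pos L_pos by (intro mult_mono) (auto simp: \<delta>_def)
    finally show ?thesis using * by linarith
  qed
  \<comment> \<open>Jensen's inequality for \<open>exp\<close>, via its tangent at \<open>u\<close>; \<open>X\<^sup>2\<close> is bounded below by its tangent at \<open>s V\<close>.\<close>
  define u where "u = \<beta> * b * s\<^sup>2 / 2 * V"
  have s_pos: "0 < s" using L by (simp add: s)
  \<comment> \<open>In fact an equality: \<open>\<beta> * b * s^2 * V = 2 * u\<close>, so the
    bracket is \<open>Z\<close>. This form exposes \<open>s * V * Z\<close>, which the bound on the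
    tilted mean of \<open>X\<close> replaces.\<close>
  have "exp u * Z \<le> exp u * ((1 - 2 * u) * Z + \<beta> * b * s * (s * V * Z))"
    by (simp add: u_def algebra_simps power2_eq_square)
  also have "\<dots> \<le> exp u * ((1 - 2 * u) * Z + \<beta> * b * s * (\<integral>x. real (X x) * W x \<partial>M))"
    using XW s_pos ab \<beta> by (intro mult_left_mono add_left_mono) auto
  also have "\<dots> = (\<integral>x. exp u * ((1 - 2 * u) * W x + \<beta> * b * s * (real (X x) * W x)) \<partial>M)"
    unfolding Z_def by (simp add: Bochner_Integration.integral_add)
  also have "\<dots> \<le> Z'"
    unfolding Z'_def
  proof (rule integral_mono)
    fix x assume x: "x \<in> space M"
    define v where "v = \<beta> * b / (2 * V) * (real (X x))\<^sup>2"
    have v_ge: "\<beta> * b * s * real (X x) - u \<le> v"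
    proof -
      have "0 \<le> \<beta> * b / (2 * V) * (real (X x) - s * V)\<^sup>2" using \<beta> ab V by simp
      also have "\<dots> = v - \<beta> * b * s * real (X x) + u"
        using V by (simp add: v_def u_def field_simps power2_eq_square)
      finally show ?thesis by linarith
    qed
    have "exp u * ((1 - 2 * u) * W x + \<beta> * b * s * (real (X x) * W x)) = exp u * (1 - 2 * u + \<beta> * b * s * real (X x)) * W x"
      by (simp add: algebra_simps)
    also have "\<dots> \<le> exp u * (1 + (v - u)) * W x"
      using v_ge by (intro mult_right_mono mult_left_mono) (auto simp: W_def)
    also have "\<dots> \<le> exp u * exp (v - u) * W x"
      by (intro mult_right_mono mult_left_mono) (auto simp: W_def)
    also have "\<dots> = exp (E \<mu> (n x) ((real (X x))\<^sup>2 + S x))"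
      using V by (simp add: W_def E_def v_def field_simps flip: exp_add)
    also have "\<dots> \<le> W' x" using E_mono[OF lower[OF x]] by (simp add: W'_def)
    finally show "exp u * ((1 - 2 * u) * W x + \<beta> * b * s * (real (X x) * W x)) \<le> W' x" .
  qed auto
  finally have "exp u * Z \<le> Z'" .
  then have "ln (exp u * Z) \<le> ln Z'" using Z_pos by (subst ln_le_cancel_iff) (auto intro: less_le_trans[rotated])
  then have "ln Z + u \<le> ln Z'" using Z_pos by (simp add: ln_mult)
  then show ?thesis by (simp add: Z_def Z'_def W_def W'_def E_def n_def u_def)
qed

section \<open>Brownian loops and the intensity measure of the soup\<close>

lemma summable_reciprocal_squares: "summable (\<lambda>i. 1 / (real (Suc i))\<^sup>2)"
  using inverse_power_summable[of 2, where 'a=real]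
  by (subst summable_Suc_iff) (simp add: field_simps)

lemma space_loops: "space (loops t) = {\<omega> \<in> {0..t} \<rightarrow>\<^sub>E UNIV. continuous_on {0..t} \<omega> \<and> \<omega> 0 = \<omega> t}"
  by (auto simp: loops_def space_restrict_space space_PiM)

lemma measurable_loops_component:
  assumes "s \<in> {0..t}"
  shows "(\<lambda>\<omega>. \<omega> s) \<in> borel_measurable (loops t :: (real \<Rightarrow> real^'d::finite) measure)"
  unfolding loops_def using assms by (intro measurable_restrict_space1) measurable

text \<open>Joint measurability in the starting point and the path, not just in the path, is what
  makes the bridge mass a measurable function of \<open>x\<close>.\<close>

lemma translate_loops_measurable:
  assumes "0 \<le> t"
  shows "(\<lambda>(x, \<omega>). \<lambda>s\<in>{0..t}. x + \<omega> s) \<in> borel \<Otimes>\<^sub>M loops t \<rightarrow>\<^sub>M (loops t :: (real \<Rightarrow> real^'d::finite) measure)"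
    (is "?f \<in> ?N \<rightarrow>\<^sub>M _")
proof -
  have "?f \<in> ?N \<rightarrow>\<^sub>M restrict_space (\<Pi>\<^sub>M s\<in>{0..t}. borel) {\<omega>. continuous_on {0..t} \<omega> \<and> \<omega> 0 = \<omega> t}"
  proof (rule measurable_restrict_space2)
    show "?f \<in> space ?N \<rightarrow> {\<omega>. continuous_on {0..t} \<omega> \<and> \<omega> 0 = \<omega> t}"
    proof
      fix p :: "(real^'d) \<times> (real \<Rightarrow> real^'d)" assume p: "p \<in> space ?N"
      then have "continuous_on {0..t} (\<lambda>s. fst p + snd p s)"
        by (auto simp: space_pair_measure space_loops intro!: continuous_intros)
      then have "continuous_on {0..t} (?f p)"
        by (rule continuous_on_eq) (auto simp: split_beta)
      then show "?f p \<in> {\<omega>. continuous_on {0..t} \<omega> \<and> \<omega> 0 = \<omega> t}"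
        using p assms by (auto simp: space_pair_measure space_loops)
    qed
    have [measurable]: "(\<lambda>p. snd p s) \<in> borel_measurable ?N" if "s \<in> {0..t}" for s
      by (rule measurable_compose[OF measurable_snd measurable_loops_component[OF that]])
    show "?f \<in> ?N \<rightarrow>\<^sub>M (\<Pi>\<^sub>M s\<in>{0..t}. borel)"
      unfolding split_beta by (rule measurable_restrict) measurable
  qed
  then show ?thesis by (simp add: loops_def)
qed

context
  fixes B :: "real \<Rightarrow> (real \<Rightarrow> real^'d::finite) measure"
  assumes bridge: "\<And>t. t > 0 \<Longrightarrow> standard_brownian_bridge t (B t)"
begin

lemma prob_space_bridge: "0 < t \<Longrightarrow> prob_space (B t)"
  and sets_bridge: "0 < t \<Longrightarrow> sets (B t) = sets (loops t)"
  using bridge[of t] by (auto simp: standard_brownian_bridge_def)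

lemma bridge_component_measurable:
  assumes "0 < t" "s \<in> {0..t}"
  shows "(\<lambda>\<omega>. \<omega> s) \<in> borel_measurable (B t)"
  using measurable_loops_component[OF assms(2)]
  by (simp add: measurable_cong_sets[OF sets_bridge[OF assms(1)] refl])

lemma translate_bridge_measurable:
  assumes "0 < t"
  shows "(\<lambda>(x, \<omega>). \<lambda>s\<in>{0..t}. x + \<omega> s) \<in> borel \<Otimes>\<^sub>M B t \<rightarrow>\<^sub>M loops t"
  using translate_loops_measurable[of t] assms
  by (simp add: measurable_cong_sets[OF sets_pair_measure_cong[OF refl sets_bridge[OF assms]] refl])

lemma translate_bridge_measurable1:
  assumes "0 < t"
  shows "(\<lambda>\<omega>. \<lambda>s\<in>{0..t}. x + \<omega> s) \<in> B t \<rightarrow>\<^sub>M loops t"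
  using measurable_Pair2[OF translate_bridge_measurable[OF assms], of x] by simp

text \<open>
  The characteristic function at time 0 forces every multiple \<open>\<omega> 0 $ i / k\<close> of a coordinate to lie in
  \<open>2 \<pi> \<int>\<close> almost surely, which for large \<open>k\<close> is possible only at 0.
\<close>

lemma AE_bridge_start:
  assumes t: "0 < t"
  shows "AE \<omega> in B t. \<omega> 0 = 0"
proof -
  interpret prob_space "B t" by (rule prob_space_bridge[OF t])
  \<comment> \<open>The covariance \<open>min s u - s * u / t\<close> vanishes at
    \<open>s = u = 0\<close>, so the cosine has mean 1; as \<open>1 - cos\<close> is nonnegative, it
    is zero almost surely.\<close>
  have cos_1: "AE \<omega> in B t. cos (v \<bullet> \<omega> 0) = 1" for v
  proof -
    have [measurable]: "(\<lambda>\<omega>. \<omega> 0) \<in> borel_measurable (B t)"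
      using t by (intro bridge_component_measurable) auto
    have int: "integrable (B t) (\<lambda>\<omega>. iexp (v \<bullet> \<omega> 0))"
      by (intro integrable_const_bound[where B=1]) auto
    have "(CLINT \<omega>|B t. iexp (\<Sum>s\<in>{0}. v \<bullet> \<omega> s)) =
       complex_of_real (exp (- (\<Sum>s\<in>{0}. \<Sum>u\<in>{0}. (v \<bullet> v) * (min s u - s * u / t)) / 2))"
      using bridge[OF t] t unfolding standard_brownian_bridge_def
      by (elim conjE allE[where x="{0}"] allE[where x="\<lambda>_. v"] impE) auto
    then have "(CLINT \<omega>|B t. iexp (v \<bullet> \<omega> 0)) = 1" by simp
    then have "(\<integral>\<omega>. cos (v \<bullet> \<omega> 0) \<partial>B t) = 1"
      using integral_Re[OF int] by (simp add: Re_exp)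
    moreover have int_cos: "integrable (B t) (\<lambda>\<omega>. cos (v \<bullet> \<omega> 0))"
      by (intro integrable_const_bound[where B=1]) auto
    ultimately have "(\<integral>\<omega>. 1 - cos (v \<bullet> \<omega> 0) \<partial>B t) = 0"
      by (simp add: prob_space)
    then show ?thesis
      using int_cos by (subst (asm) integral_nonneg_eq_0_iff_AE) auto
  qed
  have "AE \<omega> in B t. \<forall>k i. cos ((axis i (1 / real (Suc k))) \<bullet> \<omega> 0) = 1"
    by (intro AE_all_countable[THEN iffD2] allI cos_1)
  then show ?thesis
  proof (rule AE_mp, intro AE_I2 impI)
    fix \<omega> assume *: "\<forall>k i. cos ((axis i (1 / real (Suc k))) \<bullet> \<omega> 0) = 1"
    show "\<omega> 0 = 0"
    proof (rule vec_eq_iff[THEN iffD2], rule allI)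
      fix i
      obtain k where k: "\<bar>\<omega> 0 $ i\<bar> < real (Suc k)" by (meson reals_Archimedean2 less_trans lessI of_nat_less_iff)
      define y where "y = \<omega> 0 $ i / real (Suc k)"
      have "cos y = 1" using *[rule_format, of i k] by (simp add: inner_axis' y_def)
      then obtain m :: int where m: "y = of_int m * 2 * pi" by (auto simp: cos_one_2pi_int)
      have "\<bar>y\<bar> < 1" using k by (simp add: y_def abs_divide)
      then have "\<bar>of_int m :: real\<bar> * (2 * pi) < 1" using m by (simp add: abs_mult)
      moreover have "1 < 2 * pi" using pi_gt3 by simp
      ultimately have "\<bar>of_int m :: real\<bar> < 1"
        by (smt (verit) mult_left_mono mult_cancel_left1 mult.right_neutral)
      then have "m = 0" by linarith
      then show "\<omega> 0 $ i = 0 $ i" using m by (simp add: y_def)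
    qed
  qed
qed

lemma sets_unnormalised_bridge [simp]: "sets (unnormalised_bridge B t x) = sets (loops t)"
  by (simp add: unnormalised_bridge_def bridge_law_def)

lemma emeasure_unnormalised_bridge:
  assumes "0 < t" "A \<in> sets (loops t)"
  shows "emeasure (unnormalised_bridge B t x) A = ennreal ((2 * pi * t) powr (- real CARD('d) / 2)) *
    emeasure (B t) {\<omega>\<in>space (B t). (\<lambda>s\<in>{0..t}. x + \<omega> s) \<in> A}"
  unfolding unnormalised_bridge_def bridge_law_def using assms
  by (simp add: emeasure_distr[OF translate_bridge_measurable1]) (auto intro!: arg_cong2[where f="(*)"] arg_cong[where f="emeasure _"])

lemma emeasure_unnormalised_bridge_measurable:
  assumes t: "0 < t" and A: "A \<in> sets (loops t)"
  shows "(\<lambda>x. emeasure (unnormalised_bridge B t x) A) \<in> borel_measurable borel"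
proof -
  interpret prob_space "B t" by (rule prob_space_bridge[OF t])
  define Q where "Q = (\<lambda>(x, \<omega>). \<lambda>s\<in>{0..t}. x + \<omega> s) -` A \<inter> space (borel \<Otimes>\<^sub>M B t)"
  have "Q \<in> sets (borel \<Otimes>\<^sub>M B t)"
    unfolding Q_def by (rule measurable_sets[OF translate_bridge_measurable[OF t] A])
  then have "(\<lambda>x. emeasure (B t) (Pair x -` Q)) \<in> borel_measurable borel"
    by (rule measurable_emeasure_Pair)
  moreover have "Pair x -` Q = {\<omega>\<in>space (B t). (\<lambda>s\<in>{0..t}. x + \<omega> s) \<in> A}" for x
    by (auto simp: Q_def space_pair_measure)
  ultimately show ?thesis by (simp add: emeasure_unnormalised_bridge[OF t A])
qed

context
  fixes \<beta> :: real and \<Lambda> :: "(real^'d) set"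
  assumes \<beta>: "0 < \<beta>" and \<Lambda>: "\<Lambda> \<in> sets borel"
begin

lemma
  shows space_loop_intensity: "space (loop_intensity B \<beta> \<Lambda>) = Gamma_F \<beta>"
    and sets_loop_intensity: "sets (loop_intensity B \<beta> \<Lambda>) =
      sigma_sets (Gamma_F \<beta>) {{j} \<times> A | j A. 1 \<le> j \<and> A \<in> sets (loops (\<beta> * real j))}"
proof -
  have "{{j} \<times> A | j A. 1 \<le> j \<and> A \<in> sets (loops (\<beta> * real j))} \<subseteq> Pow (Gamma_F \<beta> :: 'd loop set)"
    by (auto simp: Gamma_F_def dest: sets.sets_into_space)
  then show "space (loop_intensity B \<beta> \<Lambda>) = Gamma_F \<beta>" "sets (loop_intensity B \<beta> \<Lambda>) =
      sigma_sets (Gamma_F \<beta>) {{j} \<times> A | j A. 1 \<le> j \<and> A \<in> sets (loops (\<beta> * real j))}"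
    by (simp_all add: loop_intensity_def space_measure_of_conv sets_measure_of)
qed

text \<open>Induction over the generated \<sigma>-algebra. Without this, the sections in the
  intensity could be non-measurable, where \<open>emeasure\<close> takes the default value 0. The
  index \<open>i\<close> stands for length \<open>Suc i\<close>.\<close>

lemma section_in_sets:
  assumes "A \<in> sets (loop_intensity B \<beta> \<Lambda>)"
  shows "{\<omega>. (Suc i, \<omega>) \<in> A} \<in> sets (loops (\<beta> * real (Suc i)))"
  using assms unfolding sets_loop_intensity
proof (induction A rule: sigma_sets.induct)
  case (Basic a)
  then obtain j A where "a = {j} \<times> A" "A \<in> sets (loops (\<beta> * real j))" by auto
  then show ?case by (cases "j = Suc i") auto
next
  case Empty then show ?case by simp
next
  case (Compl a)
  have "{\<omega>. (Suc i, \<omega>) \<in> Gamma_F \<beta> - a} = space (loops (\<beta> * real (Suc i))) - {\<omega>. (Suc i, \<omega>) \<in> a}"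
    by (auto simp: Gamma_F_def)
  then show ?case using Compl by auto
next
  case (Union a)
  have "{\<omega>. (Suc i, \<omega>) \<in> (\<Union>n. a n)} = (\<Union>n. {\<omega>. (Suc i, \<omega>) \<in> a n})" by auto
  then show ?case using Union by auto
qed

text \<open>\<open>measure_of\<close> yields the zero measure unless the given set function is a
  measure, so countable additivity must be proved before the formula may be used.\<close>

lemma emeasure_loop_intensity:
  assumes "A \<in> sets (loop_intensity B \<beta> \<Lambda>)"
  shows "emeasure (loop_intensity B \<beta> \<Lambda>) A = (\<integral>\<^sup>+x\<in>\<Lambda>. (\<Sum>i. ennreal (1 / real (Suc i)) *
    emeasure (unnormalised_bridge B (\<beta> * real (Suc i)) x) {\<omega>. (Suc i, \<omega>) \<in> A}) \<partial>lborel)"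
proof -
  let ?f = "\<lambda>A i x. ennreal (1 / real (Suc i)) * emeasure (unnormalised_bridge B (\<beta> * real (Suc i)) x) {\<omega>. (Suc i, \<omega>) \<in> A}"
  let ?S = "sets (loop_intensity B \<beta> \<Lambda>)"
  have meas: "?f A i \<in> borel_measurable borel" if "A \<in> ?S" for A i
    using emeasure_unnormalised_bridge_measurable[OF _ section_in_sets[OF that, of i]] \<beta> by simp
  show ?thesis
  proof (subst emeasure_measure_of[OF loop_intensity_def])
    show "{{j} \<times> A | j A. 1 \<le> j \<and> A \<in> sets (loops (\<beta> * real j))} \<subseteq> Pow (Gamma_F \<beta> :: 'd loop set)"
      by (auto simp: Gamma_F_def dest: sets.sets_into_space)
    show "positive ?S (\<lambda>A. \<integral>\<^sup>+x\<in>\<Lambda>. (\<Sum>i. let j = Suc i in ennreal (1 / real j) *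
               emeasure (unnormalised_bridge B (\<beta> * real j) x) {\<omega>. (j, \<omega>) \<in> A}) \<partial>lborel)"
      by (simp add: positive_def)
    show "countably_additive ?S (\<lambda>A. \<integral>\<^sup>+x\<in>\<Lambda>. (\<Sum>i. let j = Suc i in ennreal (1 / real j) *
               emeasure (unnormalised_bridge B (\<beta> * real j) x) {\<omega>. (j, \<omega>) \<in> A}) \<partial>lborel)"
      unfolding Let_def
    proof (rule countably_additiveI)
      fix A :: "nat \<Rightarrow> 'd loop set"
      assume A: "range A \<subseteq> ?S" "disjoint_family A" "(\<Union>n. A n) \<in> ?S"
      note meas' = meas[OF subsetD[OF A(1)], OF rangeI]
      have sum_meas: "(\<lambda>x. \<Sum>i. ?f (A n) i x) \<in> borel_measurable lborel" for n
        unfolding measurable_cong_sets[OF sets_lborel refl] by (intro borel_measurable_suminf_order meas')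
      have "(\<Sum>n. \<integral>\<^sup>+x\<in>\<Lambda>. (\<Sum>i. ?f (A n) i x) \<partial>lborel) = (\<integral>\<^sup>+x. (\<Sum>n. (\<Sum>i. ?f (A n) i x) * indicator \<Lambda> x) \<partial>lborel)"
        using \<Lambda> sum_meas
        by (intro nn_integral_suminf[symmetric] borel_measurable_times_ennreal borel_measurable_indicator) auto
      also have "\<dots> = (\<integral>\<^sup>+x\<in>\<Lambda>. (\<Sum>i. ?f (\<Union>n. A n) i x) \<partial>lborel)"
      proof (rule nn_integral_cong)
        fix x
        \<comment> \<open>Tonelli for the two sums: the one over lengths is read as an integral for
          counting measure.\<close>
        have "(\<Sum>n. (\<Sum>i. ?f (A n) i x)) = (\<Sum>i. (\<Sum>n. ?f (A n) i x))"
          using nn_integral_suminf[of "\<lambda>n i. ?f (A n) i x" "count_space UNIV"]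
          by (simp add: nn_integral_count_space_nat)
        also have "\<dots> = (\<Sum>i. ?f (\<Union>n. A n) i x)"
        proof (rule arg_cong[where f=suminf], rule ext)
          fix i
          have "(\<Sum>n. emeasure (unnormalised_bridge B (\<beta> * real (Suc i)) x) {\<omega>. (Suc i, \<omega>) \<in> A n}) =
             emeasure (unnormalised_bridge B (\<beta> * real (Suc i)) x) (\<Union>n. {\<omega>. (Suc i, \<omega>) \<in> A n})"
            using A section_in_sets by (intro suminf_emeasure) (auto simp: disjoint_family_on_def)
          then show "(\<Sum>n. ?f (A n) i x) = ?f (\<Union>n. A n) i x"
            by (simp add: Collect_ex_eq)
        qed
        finally show "(\<Sum>n. (\<Sum>i. ?f (A n) i x) * indicator \<Lambda> x) = (\<Sum>i. ?f (\<Union>n. A n) i x) * indicator \<Lambda> x"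
          by simp
      qed
      finally show "(\<Sum>n. \<integral>\<^sup>+x\<in>\<Lambda>. (\<Sum>i. ?f (A n) i x) \<partial>lborel) = (\<integral>\<^sup>+x\<in>\<Lambda>. (\<Sum>i. ?f (\<Union>n. A n) i x) \<partial>lborel)" .
    qed
  qed (use assms in \<open>simp_all add: Let_def\<close>)
qed

text \<open>The weight \<open>1/j\<close> times the heat kernel factor \<open>j^(-d/2)\<close> is at
  most \<open>1/j^2\<close> once \<open>d\<close> is at least 2. The total intensity is therefore
  finite and at most proportional to the volume.\<close>

lemma emeasure_loop_intensity_le:
  assumes "2 \<le> CARD('d)" and A: "A \<in> sets (loop_intensity B \<beta> \<Lambda>)"
  shows "emeasure (loop_intensity B \<beta> \<Lambda>) A \<le>
    ennreal ((2 * pi * \<beta>) powr (- real CARD('d) / 2) * (\<Sum>i. 1 / (real (Suc i))\<^sup>2)) * emeasure lborel \<Lambda>"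
proof -
  let ?c = "(2 * pi * \<beta>) powr (- real CARD('d) / 2)"
  have term_le: "ennreal (1 / real (Suc i)) * emeasure (unnormalised_bridge B (\<beta> * real (Suc i)) x) {\<omega>. (Suc i, \<omega>) \<in> A}
      \<le> ennreal (?c * (1 / (real (Suc i))\<^sup>2))" for i x
  proof -
    let ?t = "\<beta> * real (Suc i)"
    have t: "0 < ?t" using \<beta> by simp
    interpret prob_space "B ?t" by (rule prob_space_bridge[OF t])
    have "real (Suc i) powr (- real CARD('d) / 2) \<le> real (Suc i) powr (- 1)"
      using assms(1) by (intro powr_mono) auto
    also have "\<dots> = 1 / real (Suc i)" by (simp add: powr_minus_divide)
    finally have j: "real (Suc i) powr (- real CARD('d) / 2) \<le> 1 / real (Suc i)" .
    have "(2 * pi * ?t) powr (- real CARD('d) / 2) = ?c * real (Suc i) powr (- real CARD('d) / 2)"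
      using \<beta> by (simp add: powr_mult[symmetric] mult.assoc del: of_nat_Suc)
    also have "\<dots> \<le> ?c * (1 / real (Suc i))" using j by (intro mult_left_mono) auto
    finally have c: "(2 * pi * ?t) powr (- real CARD('d) / 2) \<le> ?c * (1 / real (Suc i))" .
    have "emeasure (unnormalised_bridge B ?t x) {\<omega>. (Suc i, \<omega>) \<in> A} \<le> ennreal ((2 * pi * ?t) powr (- real CARD('d) / 2)) * 1"
      unfolding emeasure_unnormalised_bridge[OF t section_in_sets[OF A]]
      by (intro mult_left_mono emeasure_le_1) auto
    also have "\<dots> \<le> ennreal (?c * (1 / real (Suc i)))" using c by (simp add: ennreal_leI)
    finally have "ennreal (1 / real (Suc i)) * emeasure (unnormalised_bridge B ?t x) {\<omega>. (Suc i, \<omega>) \<in> A} \<le>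
      ennreal (1 / real (Suc i)) * ennreal (?c * (1 / real (Suc i)))" by (rule mult_left_mono) simp
    also have "\<dots> = ennreal (?c * (1 / (real (Suc i))\<^sup>2))"
      by (subst ennreal_mult[symmetric]) (auto simp: power2_eq_square)
    finally show ?thesis .
  qed
  have "(\<Sum>i. ennreal (1 / real (Suc i)) * emeasure (unnormalised_bridge B (\<beta> * real (Suc i)) x) {\<omega>. (Suc i, \<omega>) \<in> A})
      \<le> ennreal (?c * (\<Sum>i. 1 / (real (Suc i))\<^sup>2))" for x
  proof -
    have "(\<Sum>i. ennreal (1 / real (Suc i)) * emeasure (unnormalised_bridge B (\<beta> * real (Suc i)) x) {\<omega>. (Suc i, \<omega>) \<in> A})
      \<le> (\<Sum>i. ennreal (?c * (1 / (real (Suc i))\<^sup>2)))"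
      by (intro suminf_le term_le) auto
    also have "\<dots> = ennreal (\<Sum>i. ?c * (1 / (real (Suc i))\<^sup>2))"
      by (intro suminf_ennreal2 summable_mult summable_reciprocal_squares) auto
    also have "\<dots> = ennreal (?c * (\<Sum>i. 1 / (real (Suc i))\<^sup>2))"
      by (subst suminf_mult[OF summable_reciprocal_squares]) simp
    finally show ?thesis .
  qed
  then have "emeasure (loop_intensity B \<beta> \<Lambda>) A \<le> (\<integral>\<^sup>+x. ennreal (?c * (\<Sum>i. 1 / (real (Suc i))\<^sup>2)) * indicator \<Lambda> x \<partial>lborel)"
    unfolding emeasure_loop_intensity[OF A] by (intro nn_integral_mono mult_right_mono) auto
  also have "\<dots> = ennreal (?c * (\<Sum>i. 1 / (real (Suc i))\<^sup>2)) * emeasure lborel \<Lambda>"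
    using \<Lambda> by (intro nn_integral_cmult_indicator) auto
  finally show ?thesis .
qed

lemma cycle_set_in_sets:
  "{w \<in> Gamma_F \<beta>. loop_length w = k \<and> loop_start w \<in> \<Lambda>} \<in> sets (loop_intensity B \<beta> \<Lambda>)" (is "?A \<in> _")
proof (cases k)
  case 0
  then have "?A = {}" by (auto simp: Gamma_F_def loop_length_def)
  then show ?thesis by (metis sets.empty_sets)
next
  case (Suc j)
  have "?A = {k} \<times> {\<omega> \<in> space (loops (\<beta> * real k)). \<omega> 0 \<in> \<Lambda>}"
    using Suc by (auto simp: Gamma_F_def loop_length_def loop_start_def)
  moreover have "{\<omega> \<in> space (loops (\<beta> * real k)). \<omega> 0 \<in> \<Lambda>} \<in> sets (loops (\<beta> * real k))"
    using measurable_sets[OF measurable_loops_component[of 0 "\<beta> * real k"] \<Lambda>] \<beta>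
    by (simp add: vimage_def Collect_conj_eq Int_commute)
  moreover have "1 \<le> k" using Suc by simp
  ultimately show ?thesis
    unfolding sets_loop_intensity by (intro sigma_sets.Basic) blast
qed

text \<open>Only the summand of length 1 is kept. A bridge from \<open>x\<close> almost surely
  starts at \<open>x\<close>, so for \<open>x\<close> in \<Lambda> its whole mass is
  counted.\<close>

lemma emeasure_unit_cycles_ge:
  "ennreal ((2 * pi * \<beta>) powr (- real CARD('d) / 2)) * emeasure lborel \<Lambda> \<le>
    emeasure (loop_intensity B \<beta> \<Lambda>) {w \<in> Gamma_F \<beta>. loop_length w = 1 \<and> loop_start w \<in> \<Lambda>}"
    (is "ennreal ?c * _ \<le> emeasure _ ?A")
proof -
  note A = cycle_set_in_sets[of 1]
  interpret prob_space "B \<beta>" by (rule prob_space_bridge[OF \<beta>])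
  let ?S = "\<lambda>x. {\<omega> \<in> space (B \<beta>). (\<lambda>s\<in>{0..\<beta>}. x + \<omega> s) \<in> {\<omega>. (1, \<omega>) \<in> ?A}}"
  have S1: "emeasure (B \<beta>) (?S x) = 1" if "x \<in> \<Lambda>" for x
  proof (rule emeasure_eq_1_AE)
    have "{\<omega>. (1, \<omega>) \<in> ?A} \<in> sets (loops \<beta>)" using section_in_sets[OF A, of 0] by simp
    from measurable_sets[OF translate_bridge_measurable1[OF \<beta>, of x] this]
    show "?S x \<in> events" by (simp add: vimage_def Collect_conj_eq Int_commute)
    show "AE \<omega> in B \<beta>. \<omega> \<in> ?S x"
      using AE_bridge_start[OF \<beta>] AE_space
    proof eventually_elim
      case (elim \<omega>)
      have "(\<lambda>s\<in>{0..\<beta>}. x + \<omega> s) \<in> space (loops \<beta>)"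
        by (rule measurable_space[OF translate_bridge_measurable1[OF \<beta>] elim(2)])
      then show ?case
        using elim that \<beta> by (simp add: Gamma_F_def loop_length_def loop_start_def)
    qed
  qed
  have "ennreal ?c * emeasure lborel \<Lambda> = (\<integral>\<^sup>+x. ennreal ?c * indicator \<Lambda> x \<partial>lborel)"
    using \<Lambda> by (intro nn_integral_cmult_indicator[symmetric]) auto
  also have "\<dots> \<le> emeasure (loop_intensity B \<beta> \<Lambda>) ?A"
    unfolding emeasure_loop_intensity[OF A]
  proof (rule nn_integral_mono)
    fix x
    let ?f = "\<lambda>i. ennreal (1 / real (Suc i)) * emeasure (unnormalised_bridge B (\<beta> * real (Suc i)) x) {\<omega>. (Suc i, \<omega>) \<in> ?A}"
    have "ennreal ?c \<le> (\<Sum>i. ?f i)" if "x \<in> \<Lambda>"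
    proof -
      have "ennreal ?c = ?f 0"
        using S1[OF that] emeasure_unnormalised_bridge[OF \<beta>, of "{\<omega>. (1, \<omega>) \<in> ?A}" x] section_in_sets[OF A, of 0]
        by simp
      also have "\<dots> \<le> (\<Sum>i. ?f i)"
        using sum_le_suminf[of ?f "{0}"] by simp
      finally show ?thesis .
    qed
    then show "ennreal ?c * indicator \<Lambda> x \<le> (\<Sum>i. ?f i) * indicator \<Lambda> x"
      by (auto simp: indicator_def simp del: of_nat_Suc)
  qed
  finally show ?thesis .
qed

end

end

section \<open>Occupation numbers and Poisson counts\<close>

lemma sum_mset_by_value:
  fixes f :: "'a \<Rightarrow> nat"
  assumes "finite F" "f ` set_mset M \<subseteq> F"
  shows "(\<Sum>x\<in>#M. f x) = (\<Sum>k\<in>F. k * size {#x \<in># M. f x = k#})"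
  using assms(2)
proof (induction M)
  case empty then show ?case by simp
next
  case (add x M)
  have "(\<Sum>k\<in>F. k * size {#y \<in># add_mset x M. f y = k#}) =
      (\<Sum>k\<in>F. (if f x = k then k else 0) + k * size {#y \<in># M. f y = k#})"
    by (intro sum.cong) auto
  also have "\<dots> = f x + (\<Sum>k\<in>F. k * size {#y \<in># M. f y = k#})"
    using add.prems assms(1) by (simp add: sum.distrib)
  finally show ?case using add by simp
qed

lemma sum_power2_le_power2_sum:
  fixes f :: "'a \<Rightarrow> real"
  assumes "finite F" "\<And>k. k \<in> F \<Longrightarrow> 0 \<le> f k"
  shows "(\<Sum>k\<in>F. (f k)\<^sup>2) \<le> (\<Sum>k\<in>F. f k)\<^sup>2"
proof -
  have "(\<Sum>k\<in>F. (f k)\<^sup>2) \<le> (\<Sum>k\<in>F. f k * (\<Sum>k\<in>F. f k))"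
    unfolding power2_eq_square using assms by (intro sum_mono mult_left_mono member_le_sum) auto
  then show ?thesis by (simp add: power2_eq_square sum_distrib_right)
qed

context
  fixes \<nu> :: "'x measure" and P :: "'x multiset measure"
  assumes ppp: "poisson_point_process \<nu> P"
begin

lemma prob_space_ppp: "prob_space P"
  using ppp by (simp add: poisson_point_process_def)

lemma space_ppp: "space P = {\<eta>. set_mset \<eta> \<subseteq> space \<nu>}"
  using ppp by (simp add: poisson_point_process_def configurations_def space_measure_of_conv)

lemma prob_count_points:
  assumes "A \<in> sets \<nu>" "emeasure \<nu> A < \<infinity>"
  shows "measure P {\<eta>\<in>space P. count_points A \<eta> = k} = measure \<nu> A ^ k / fact k * exp (- measure \<nu> A)"
  using ppp assms unfolding poisson_point_process_def by blast

text \<open>Loop lengths are unbounded, so the whole infinite family is needed; independence of a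
  family is a property of its finite subfamilies.\<close>

lemma indep_count_points:
  fixes A :: "nat \<Rightarrow> 'x set"
  assumes "disjoint_family A" "range A \<subseteq> sets \<nu>"
  shows "prob_space.indep_vars P (\<lambda>_. count_space UNIV) (\<lambda>i. count_points (A i)) UNIV"
proof -
  interpret prob_space P by (rule prob_space_ppp)
  have fin: "indep_vars (\<lambda>_. count_space UNIV) (\<lambda>i. count_points (A i)) I" if "finite I" for I
  proof -
    have "disjoint_family_on A I" "A ` I \<subseteq> sets \<nu>"
      using assms by (auto simp: disjoint_family_on_def)
    then show ?thesis
      using ppp that unfolding poisson_point_process_def by blast
  qed
  show ?thesis
    using fin[of "{_}"] fin unfolding indep_vars_def2
    by (subst indep_sets_finite_index_sets) auto
qed

end

text \<open>\<open>indep_var\<close> relates variables with one common value type, whereas a count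
  is to be independent of a pair of reals. Hence the conclusion is a factorisation of the joint
  law.\<close>

lemma (in prob_space) indep_var_distr_compose:
  assumes indep: "indep_var S U T V" and f: "f \<in> measurable S S'" and g: "g \<in> measurable T T'"
  shows "distr M S' (\<lambda>x. f (U x)) \<Otimes>\<^sub>M distr M T' (\<lambda>x. g (V x)) =
    distr M (S' \<Otimes>\<^sub>M T') (\<lambda>x. (f (U x), g (V x)))"
proof -
  have U[measurable]: "U \<in> measurable M S" and V[measurable]: "V \<in> measurable M T"
    using indep by (auto dest: indep_var_rv1 indep_var_rv2)
  note [measurable] = f g
  interpret D: prob_space "distr (distr M T V) T' g"
    by (intro prob_space.prob_space_distr prob_space_distr) auto
  have "distr (distr M S U) S' f \<Otimes>\<^sub>M distr (distr M T V) T' g =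
      distr (distr M S U \<Otimes>\<^sub>M distr M T V) (S' \<Otimes>\<^sub>M T') (\<lambda>(x, y). (f x, g y))"
    by (rule pair_measure_distr) (auto intro: D.sigma_finite_measure_axioms)
  also have "\<dots> = distr (distr M (S \<Otimes>\<^sub>M T) (\<lambda>x. (U x, V x))) (S' \<Otimes>\<^sub>M T') (\<lambda>(x, y). (f x, g y))"
    using indep by (simp add: indep_var_distribution_eq)
  finally show ?thesis
    by (simp add: distr_distr comp_def)
qed

section \<open>Cubes, the cut-off scale and series of finite support\<close>

lemma cube_measure:
  shows cube_borel: "(cube n :: (real^'d::finite) set) \<in> sets borel"
    and emeasure_cube_finite: "emeasure lborel (cube n :: (real^'d) set) < \<infinity>"
    and measure_cube_ge: "real n \<le> measure lborel (cube n :: (real^'d) set)"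
proof -
  let ?C = "cube n :: (real^'d) set"
  show C: "?C \<in> sets borel" unfolding cube_def by measurable
  have "?C \<subseteq> cbox (\<chi> i. - (real n / 2)) (\<chi> i. real n / 2)"
    by (auto simp: cube_def mem_box_cart less_imp_le)
  then have "emeasure lborel ?C \<le> emeasure lborel (cbox (\<chi> i. - (real n / 2)) (\<chi> i. real n / 2) :: (real^'d) set)"
    by (rule emeasure_mono) simp
  also have "\<dots> < \<infinity>" by (rule emeasure_lborel_cbox_finite)
  finally show fin: "emeasure lborel ?C < \<infinity>" .
  let ?b = "box (\<chi> i. - (real n / 2)) (\<chi> i. real n / 2) :: (real^'d) set"
  have "real n ^ 1 \<le> real n ^ CARD('d)" if "n \<noteq> 0"
    using that by (intro power_increasing) (auto simp: Suc_le_eq)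
  then have "real n \<le> real n ^ CARD('d)" by (cases "n = 0") auto
  also have "\<dots> = measure lborel ?b"
  proof -
    have "measure lborel ?b = measure lborel (cbox (\<chi> i. - (real n / 2)) (\<chi> i. real n / 2) :: (real^'d) set)"
      by (simp only: measure_lborel_box_eq measure_lborel_cbox_eq)
    also have "\<dots> = real n ^ CARD('d)"
      by (subst content_cbox_cart) (auto simp: cbox_interval mem_box_cart less_eq_vec_def)
    finally show ?thesis by simp
  qed
  also have "\<dots> \<le> measure lborel ?C"
    using fin C by (intro measure_mono_fmeasurable) (auto simp: cube_def mem_box_cart less_imp_le fmeasurable_def)
  finally show "real n \<le> measure lborel ?C" .
qed

text \<open>The scale is eventually at least 1 and is \<open>o(q)\<close>; constant 1/2 in the
  little-o bound gives 2. From then on loops of length 1 are absent from the cut-off sum.\<close>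

lemma admissible_cutoff_eventually_ge:
  assumes "admissible_cutoff TYPE('d::finite) q"
  shows "eventually (\<lambda>n. 2 \<le> q n) sequentially"
proof -
  let ?V = "\<lambda>n. measure lborel (cube n :: (real^'d) set)"
  have "eventually (\<lambda>n. norm (scale CARD('d) (?V n)) \<le> 1 / 2 * norm (real (q n))) sequentially"
    using assms unfolding admissible_cutoff_def by (auto dest: landau_o.smallD[where c="1/2"])
  \<comment> \<open>3 exceeds e, which makes the logarithm in dimension 4 at least 1.\<close>
  moreover have "eventually (\<lambda>n. 3 \<le> n) sequentially" by (rule eventually_ge_at_top)
  ultimately show ?thesis
  proof eventually_elim
    case (elim n)
    have V: "3 \<le> ?V n" using elim(2) measure_cube_ge[of n, where 'd='d] by linarith
    have "exp 1 \<le> ?V n" using exp_le V by linarith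
    then have "1 \<le> ln (?V n)" using V by (subst ln_ge_iff) auto
    then have "1 \<le> scale CARD('d) (?V n)"
      using V by (auto simp: scale_def ge_one_powr_ge_zero intro!: mult_ge1_I)
    then show ?case using elim(1) by simp
  qed
qed

lemma infsum_eq_sum_of_bounded_support:
  fixes f :: "nat \<Rightarrow> real"
  assumes "\<And>k. K \<le> k \<Longrightarrow> f k = 0"
  shows "(\<Sum>\<^sub>\<infinity>k\<in>{m..}. f k) = (\<Sum>k\<in>{m..<K}. f k)"
proof -
  have "(\<Sum>\<^sub>\<infinity>k\<in>{m..}. f k) = (\<Sum>\<^sub>\<infinity>k\<in>{m..<K}. f k)"
    using assms by (intro infsum_cong_neutral) auto
  then show ?thesis by simp
qed

lemma suminf_eq_sum_of_bounded_support:
  fixes f :: "nat \<Rightarrow> real"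
  assumes "\<And>k. K \<le> k \<Longrightarrow> f k = 0"
  shows "(\<Sum>k. if m \<le> k then f k else 0) = (\<Sum>k\<in>{m..<K}. f k)"
proof -
  have "(\<Sum>k. if m \<le> k then f k else 0) = (\<Sum>k\<in>{m..<K}. if m \<le> k then f k else 0)"
    using assms by (intro suminf_finite) auto
  then show ?thesis by simp
qed

section \<open>The gap in finite volume and its limit\<close>

lemma finite_volume_pressure_gap:
  fixes B :: "real \<Rightarrow> (real \<Rightarrow> real^'d::finite) measure"
    and P :: "nat \<Rightarrow> 'd loop multiset measure"
  assumes dim: "2 \<le> CARD('d)" and ab: "b < a" "0 < b" and \<beta>: "0 < \<beta>"
    and bridge: "\<And>t. t > 0 \<Longrightarrow> standard_brownian_bridge t (B t)"
    and ppp: "poisson_point_process (loop_intensity B \<beta> (cube n)) (P n)"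
    and n: "1 \<le> n" and q: "2 \<le> q n"
    and c: "c = (2 * pi * \<beta>) powr (- real CARD('d) / 2) * (\<Sum>i. 1 / (real (Suc i))\<^sup>2)"
    and K: "1 \<le> K" "\<beta> * \<bar>\<mu>\<bar> + c + 1 \<le> \<beta> * (a - b) / 2 * K"
    and s: "s = (2 * pi * \<beta>) powr (- real CARD('d) / 2) / 2 * exp (\<beta> * \<mu> - \<beta> * a * (K + 1))"
  shows "finite_volume_pressure P a b q \<beta> \<mu> n + b * s\<^sup>2 / 2 \<le> finite_volume_pressure P a b (\<lambda>_. 1) \<beta> \<mu> n"
proof -
  let ?\<Lambda> = "cube n :: (real^'d) set"
  define V where "V = measure lborel ?\<Lambda>"
  have V1: "1 \<le> V" using measure_cube_ge[of n, where 'd='d] n by (simp add: V_def)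
  have emV: "emeasure lborel ?\<Lambda> = ennreal V"
    unfolding V_def using emeasure_cube_finite[where 'd='d, of n]
    by (intro emeasure_eq_ennreal_measure) auto
  define \<nu> where "\<nu> = loop_intensity B \<beta> ?\<Lambda>"
  note ppp = ppp[folded \<nu>_def]
  interpret prob_space "P n" by (rule prob_space_ppp[OF ppp])
  define A where "A k = {w \<in> Gamma_F \<beta>. loop_length w = k \<and> loop_start w \<in> ?\<Lambda>}" for k
  note intensity_facts = bridge \<beta> cube_borel[of n]
  have A[measurable]: "A k \<in> sets \<nu>" for k
    unfolding A_def \<nu>_def by (rule cycle_set_in_sets[OF intensity_facts])
  have c_nonneg: "0 \<le> c"
    unfolding c by (intro mult_nonneg_nonneg suminf_nonneg summable_reciprocal_squares) auto
  have \<nu>_le: "emeasure \<nu> C \<le> ennreal (c * V)" if "C \<in> sets \<nu>" for C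
    using emeasure_loop_intensity_le[OF intensity_facts dim] that c_nonneg V1
    by (simp add: \<nu>_def c emV ennreal_mult)
  have \<nu>_fin: "emeasure \<nu> C < \<infinity>" if "C \<in> sets \<nu>" for C
    using \<nu>_le[OF that] by (rule le_less_trans) simp
  define D where "D k \<eta> = count_points (A k) \<eta>" for k \<eta>
  have indep: "indep_vars (\<lambda>_. count_space UNIV) D UNIV"
    unfolding D_def by (rule indep_count_points[OF ppp]) (use A in \<open>auto simp: disjoint_family_on_def A_def\<close>)
  define L where "L = measure \<nu> (A 1)"
  have poisson: "prob {\<eta>\<in>space (P n). D 1 \<eta> = k} = L ^ k / fact k * exp (- L)" for k
    unfolding D_def L_def by (intro prob_count_points[OF ppp] A \<nu>_fin)
  \<comment> \<open>Particle number and sum of squares as functions of the whole vector of cycle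
    counts. They depend only on coordinates from \<open>m\<close> on. The series may diverge for a
    general \<open>y\<close>, but a finite configuration gives a vector of finite support.\<close>
  define f where "f m y = (\<Sum>k. if m \<le> k then real k * real (y k) else 0)" for m :: nat and y :: "nat \<Rightarrow> nat"
  define g where "g m y = (\<Sum>k. if m \<le> k then (real k)\<^sup>2 * (real (y k))\<^sup>2 else 0)" for m :: nat and y :: "nat \<Rightarrow> nat"
  let ?PiM = "\<lambda>I. PiM I (\<lambda>_. count_space UNIV) :: (nat \<Rightarrow> nat) measure"
  have f_meas: "f m \<in> borel_measurable (?PiM I)" and g_meas: "g m \<in> borel_measurable (?PiM I)" if "{m..} \<subseteq> I" for m I
  proof -
    have [measurable]: "(\<lambda>y. y k) \<in> measurable (?PiM I) (count_space UNIV)" if "m \<le> k" for k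
      using that \<open>{m..} \<subseteq> I\<close> by (intro measurable_component_singleton) auto
    have "(\<lambda>y. if m \<le> k then real k * real (y k) else 0) \<in> borel_measurable (?PiM I)" for k
      by (cases "m \<le> k") auto
    then show "f m \<in> borel_measurable (?PiM I)" unfolding f_def by (rule borel_measurable_suminf)
    have "(\<lambda>y. if m \<le> k then (real k)\<^sup>2 * (real (y k))\<^sup>2 else 0) \<in> borel_measurable (?PiM I)" for k
      by (cases "m \<le> k") auto
    then show "g m \<in> borel_measurable (?PiM I)" unfolding g_def by (rule borel_measurable_suminf)
  qed
  define U where "U I \<eta> = restrict (\<lambda>k. D k \<eta>) I" for I \<eta>
  have U_meas: "U I \<in> measurable (P n) (?PiM I)" for I
    unfolding U_def using indep by (intro measurable_restrict) (auto simp: indep_vars_def)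
  define X where "X = D 1"
  \<comment> \<open>\<open>Y\<close> and \<open>S\<close> read only the counts of lengths at least 2
    (for \<open>S\<close> because \<open>2 \<le> q n\<close>), while \<open>X\<close> reads length
    1; this is the source of their independence.\<close>
  define Y where "Y \<eta> = f 2 (U {2..} \<eta>)" for \<eta>
  define S where "S \<eta> = g (q n) (U {2..} \<eta>)" for \<eta>
  define T where "T \<eta> = g 1 (U {1..} \<eta>)" for \<eta>
  have X: "X \<in> measurable (P n) (count_space UNIV)"
    unfolding X_def using indep by (auto simp: indep_vars_def)
  have Y: "Y \<in> borel_measurable (P n)" and S: "S \<in> borel_measurable (P n)" and T: "T \<in> borel_measurable (P n)"
    unfolding Y_def S_def T_def using q
    by (auto intro!: measurable_compose[OF U_meas f_meas] measurable_compose[OF U_meas g_meas])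
  have indep_XYS: "distr (P n) (count_space UNIV) X \<Otimes>\<^sub>M distr (P n) (borel \<Otimes>\<^sub>M borel) (\<lambda>\<eta>. (Y \<eta>, S \<eta>)) =
      distr (P n) (count_space UNIV \<Otimes>\<^sub>M (borel \<Otimes>\<^sub>M borel)) (\<lambda>\<eta>. (X \<eta>, Y \<eta>, S \<eta>))"
  proof -
    have "indep_var (?PiM {1}) (U {1}) (?PiM {2..}) (U {2..})"
      unfolding U_def by (rule indep_var_restrict[OF indep]) auto
    moreover have "(\<lambda>y. y 1) \<in> measurable (?PiM {1}) (count_space UNIV)"
      by (rule measurable_component_singleton) simp
    moreover have "(\<lambda>y. (f 2 y, g (q n) y)) \<in> measurable (?PiM {2..}) (borel \<Otimes>\<^sub>M borel)"
      using q by (intro measurable_Pair f_meas g_meas) auto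
    ultimately have "distr (P n) (count_space UNIV) (\<lambda>\<eta>. U {1} \<eta> 1) \<Otimes>\<^sub>M
        distr (P n) (borel \<Otimes>\<^sub>M borel) (\<lambda>\<eta>. (f 2 (U {2..} \<eta>), g (q n) (U {2..} \<eta>))) =
      distr (P n) (count_space UNIV \<Otimes>\<^sub>M (borel \<Otimes>\<^sub>M borel)) (\<lambda>\<eta>. (U {1} \<eta> 1, f 2 (U {2..} \<eta>), g (q n) (U {2..} \<eta>)))"
      by (rule indep_var_distr_compose)
    then show ?thesis by (simp add: X_def Y_def S_def U_def)
  qed
  have space_P: "space (P n) = {\<eta>. set_mset \<eta> \<subseteq> Gamma_F \<beta>}"
    unfolding space_ppp[OF ppp] \<nu>_def by (simp add: space_loop_intensity[OF intensity_facts])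
  have occupation: "real (particle_number ?\<Lambda> \<eta>) = real (X \<eta>) + Y \<eta> \<and>
      (\<Sum>\<^sub>\<infinity>k\<in>{q n..}. (real k)\<^sup>2 * (real (cycle_count ?\<Lambda> k \<eta>))\<^sup>2) = S \<eta> \<and>
      (\<Sum>\<^sub>\<infinity>k\<in>{1..}. (real k)\<^sup>2 * (real (cycle_count ?\<Lambda> k \<eta>))\<^sup>2) = T \<eta> \<and>
      0 \<le> Y \<eta> \<and> 0 \<le> S \<eta> \<and> (real (X \<eta>))\<^sup>2 + S \<eta> \<le> T \<eta> \<and> T \<eta> \<le> (real (X \<eta>) + Y \<eta>)\<^sup>2"
    if \<eta>: "\<eta> \<in> space (P n)" for \<eta>
  proof -
    have cycle: "cycle_count ?\<Lambda> k \<eta> = D k \<eta>" for k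
      using \<eta> unfolding space_P cycle_count_def D_def count_points_def A_def
      by (intro arg_cong[where f=size] filter_mset_cong) auto
    obtain M where M: "loop_length w < M" if "w \<in># \<eta>" for w
      using finite_nat_set_iff_bounded[of "loop_length ` set_mset \<eta>"] by auto
    \<comment> \<open>All loop lengths in \<eta> lie below \<open>H\<close>, so every series becomes
      a finite sum; \<open>H\<close> at least 2 allows the term of length 1 to be split off.\<close>
    define H where "H = max M 2"
    have H: "2 \<le> H" "loop_length w < H" if "w \<in># \<eta>" for w using M[OF that] by (auto simp: H_def)
    have H2: "2 \<le> H" by (simp add: H_def)
    have D0: "D k \<eta> = 0" if "H \<le> k" for k
    proof -
      have "{#w \<in># \<eta>. w \<in> A k#} = {#w \<in># \<eta>. False#}"
        using that by (intro filter_mset_cong refl) (auto simp: A_def dest: H(2))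
      then show ?thesis by (simp add: D_def count_points_def)
    qed
    have "particle_number ?\<Lambda> \<eta> = (\<Sum>k\<in>{0..<H}. k * size {#w \<in># {#w \<in># \<eta>. loop_start w \<in> ?\<Lambda>#}. loop_length w = k#})"
      unfolding particle_number_def using H(2) by (intro sum_mset_by_value) auto
    also have "\<dots> = (\<Sum>k\<in>{0..<H}. k * D k \<eta>)"
      by (simp add: cycle_count_def filter_filter_mset conj_commute flip: cycle)
    finally have N: "real (particle_number ?\<Lambda> \<eta>) = (\<Sum>k\<in>{0..<H}. real k * real (D k \<eta>))" by simp
    have Y_sum: "Y \<eta> = (\<Sum>k\<in>{2..<H}. real k * real (D k \<eta>))"
    proof -
      have "Y \<eta> = (\<Sum>k. if 2 \<le> k then real k * real (D k \<eta>) else 0)"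
        unfolding Y_def f_def U_def by (intro suminf_cong) auto
      then show ?thesis using D0 by (simp add: suminf_eq_sum_of_bounded_support)
    qed
    have g_sum: "g m (U {r..} \<eta>) = (\<Sum>k\<in>{m..<H}. (real k)\<^sup>2 * (real (D k \<eta>))\<^sup>2)" if "r \<le> m" for m r
    proof -
      have "g m (U {r..} \<eta>) = (\<Sum>k. if m \<le> k then (real k)\<^sup>2 * (real (D k \<eta>))\<^sup>2 else 0)"
        unfolding g_def U_def using that by (intro suminf_cong) auto
      then show ?thesis using D0 by (simp add: suminf_eq_sum_of_bounded_support)
    qed
    have S_sum: "S \<eta> = (\<Sum>k\<in>{q n..<H}. (real k)\<^sup>2 * (real (D k \<eta>))\<^sup>2)"
      unfolding S_def using q by (rule g_sum)
    have T_sum: "T \<eta> = (\<Sum>k\<in>{1..<H}. (real k)\<^sup>2 * (real (D k \<eta>))\<^sup>2)"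
      unfolding T_def by (rule g_sum) simp
    have inf_sum: "(\<Sum>\<^sub>\<infinity>k\<in>{m..}. (real k)\<^sup>2 * (real (cycle_count ?\<Lambda> k \<eta>))\<^sup>2) = (\<Sum>k\<in>{m..<H}. (real k)\<^sup>2 * (real (D k \<eta>))\<^sup>2)" for m
      unfolding cycle using D0 by (intro infsum_eq_sum_of_bounded_support) simp
    have split: "{0..<H} = insert 0 (insert 1 {2..<H})" "{1..<H} = insert 1 {2..<H}"
      using H2 by auto
    have XY: "real (X \<eta>) + Y \<eta> = (\<Sum>k\<in>{0..<H}. real k * real (D k \<eta>))"
      unfolding split by (simp add: X_def Y_sum)
    have "(\<Sum>k\<in>{q n..<H}. (real k)\<^sup>2 * (real (D k \<eta>))\<^sup>2) \<le> (\<Sum>k\<in>{2..<H}. (real k)\<^sup>2 * (real (D k \<eta>))\<^sup>2)"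
      using q by (intro sum_mono2) auto
    then have "(real (X \<eta>))\<^sup>2 + S \<eta> \<le> T \<eta>"
      unfolding S_sum T_sum split by (simp add: X_def)
    moreover have "T \<eta> \<le> (real (X \<eta>) + Y \<eta>)\<^sup>2"
    proof -
      have "T \<eta> \<le> (\<Sum>k\<in>{0..<H}. (real k * real (D k \<eta>))\<^sup>2)"
        unfolding T_sum power_mult_distrib by (intro sum_mono2) auto
      also have "\<dots> \<le> (real (X \<eta>) + Y \<eta>)\<^sup>2"
        unfolding XY by (intro sum_power2_le_power2_sum) auto
      finally show ?thesis .
    qed
    moreover have "0 \<le> Y \<eta>" "0 \<le> S \<eta>"
      unfolding Y_sum S_sum by (auto intro!: sum_nonneg)
    ultimately show ?thesis
      unfolding N inf_sum XY[symmetric] S_sum[symmetric] T_sum[symmetric] by simp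
  qed
  have weight: "(\<integral>\<eta>. exp (\<beta> * \<mu> * real (particle_number ?\<Lambda> \<eta>) - \<beta> * hamiltonian a b (q n) ?\<Lambda> \<eta>) \<partial>P n) =
      (\<integral>\<eta>. exp (\<beta> * \<mu> * (real (X \<eta>) + Y \<eta>) - \<beta> * (a / (2 * V) * (real (X \<eta>) + Y \<eta>)\<^sup>2 - b / (2 * V) * S \<eta>)) \<partial>P n)"
    "(\<integral>\<eta>. exp (\<beta> * \<mu> * real (particle_number ?\<Lambda> \<eta>) - \<beta> * hamiltonian a b 1 ?\<Lambda> \<eta>) \<partial>P n) =
      (\<integral>\<eta>. exp (\<beta> * \<mu> * (real (X \<eta>) + Y \<eta>) - \<beta> * (a / (2 * V) * (real (X \<eta>) + Y \<eta>)\<^sup>2 - b / (2 * V) * T \<eta>)) \<partial>P n)"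
    by (intro Bochner_Integration.integral_cong refl; simp only: hamiltonian_def V_def occupation)+
  \<comment> \<open>The soup has no loop at all with probability \<open>exp\<close> of minus the
    total intensity, which is at most \<open>c * V\<close>.\<close>
  have empty: "exp (- c * V) \<le> prob {\<eta>\<in>space (P n). real (X \<eta>) + Y \<eta> = 0}"
  proof -
    have top: "space \<nu> \<in> sets \<nu>" by simp
    have "measure \<nu> (space \<nu>) \<le> c * V"
      unfolding measure_def using \<nu>_le[OF top] c_nonneg V1 by (intro enn2real_leI) auto
    then have "exp (- c * V) \<le> exp (- measure \<nu> (space \<nu>))" by simp
    also have "\<dots> = prob {\<eta>\<in>space (P n). count_points (space \<nu>) \<eta> = 0}"
      using prob_count_points[OF ppp top \<nu>_fin[OF top], of 0] by simp
    also have "\<dots> \<le> prob {\<eta>\<in>space (P n). real (X \<eta>) + Y \<eta> = 0}"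
    proof (rule finite_measure_mono)
      show "{\<eta>\<in>space (P n). count_points (space \<nu>) \<eta> = 0} \<subseteq> {\<eta>\<in>space (P n). real (X \<eta>) + Y \<eta> = 0}"
      proof safe
        fix \<eta> assume \<eta>: "\<eta> \<in> space (P n)" "count_points (space \<nu>) \<eta> = 0"
        then have "{#w \<in># \<eta>. w \<in> space \<nu>#} = {#w \<in># \<eta>. True#}"
          unfolding space_ppp[OF ppp] by (intro filter_mset_cong refl) auto
        then have "\<eta> = {#}" using \<eta>(2) by (simp add: count_points_def)
        then show "real (X \<eta>) + Y \<eta> = 0"
          using occupation[OF \<eta>(1)] by (simp add: particle_number_def)
      qed
      show "{\<eta>\<in>space (P n). real (X \<eta>) + Y \<eta> = 0} \<in> events"
        using X Y by measurable
    qed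
    finally show ?thesis .
  qed
  have L_ge: "(2 * pi * \<beta>) powr (- real CARD('d) / 2) * V \<le> L"
  proof -
    have "ennreal ((2 * pi * \<beta>) powr (- real CARD('d) / 2) * V) \<le> emeasure \<nu> (A 1)"
      using emeasure_unit_cycles_ge[OF intensity_facts] V1
      by (simp add: \<nu>_def A_def emV ennreal_mult)
    also have "\<dots> = ennreal L"
      unfolding L_def using \<nu>_fin[OF A, of 1] by (intro emeasure_eq_ennreal_measure) auto
    finally show ?thesis by (simp add: L_def)
  qed
  let ?I = "\<lambda>R. \<integral>\<eta>. exp (\<beta> * \<mu> * (real (X \<eta>) + Y \<eta>) - \<beta> * (a / (2 * V) * (real (X \<eta>) + Y \<eta>)\<^sup>2 - b / (2 * V) * R \<eta>)) \<partial>P n"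
  have "ln (?I S) + \<beta> * b * s\<^sup>2 / 2 * V \<le> ln (?I T)"
    by (rule tilted_gap[OF X Y S indep_XYS poisson[folded X_def] T _ _ _ _ empty V1 L_ge _ ab \<beta> c_nonneg K s])
      (use occupation \<beta> in auto)
  then have "1 / (\<beta> * V) * (ln (?I S) + \<beta> * b * s\<^sup>2 / 2 * V) \<le> 1 / (\<beta> * V) * ln (?I T)"
    using \<beta> V1 by (intro mult_left_mono) auto
  moreover have "1 / (\<beta> * V) * (\<beta> * b * s\<^sup>2 / 2 * V) = b * s\<^sup>2 / 2"
    using \<beta> V1 by simp
  ultimately show ?thesis
    unfolding finite_volume_pressure_def weight by (simp only: V_def[symmetric] distrib_left)
qed

theorem proposition2p4:
  fixes B :: "real \<Rightarrow> (real \<Rightarrow> real^'d::finite) measure"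
    and P :: "nat \<Rightarrow> 'd loop multiset measure"
    and a b \<beta> \<mu> :: real
    and q :: "nat \<Rightarrow> nat"
  assumes "CARD('d) \<ge> 3"
    and "a > b" and "b > 0"
    and "\<beta> > 0"
    and "admissible_cutoff TYPE('d) q"
    and "\<And>t. t > 0 \<Longrightarrow> standard_brownian_bridge t (B t)"
    and "\<And>n. poisson_point_process (loop_intensity B \<beta> (cube n)) (P n)"
    and "convergent (finite_volume_pressure P a b q \<beta> \<mu>)"
    and "convergent (finite_volume_pressure P a b (\<lambda>_. 1) \<beta> \<mu>)"
  shows "pressure_HYL P a b q \<beta> \<mu> < pressure_HYL_full P a b \<beta> \<mu>"
proof -
  define c where "c = (2 * pi * \<beta>) powr (- real CARD('d) / 2) * (\<Sum>i. 1 / (real (Suc i))\<^sup>2)"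
  \<comment> \<open>The second entry solves the tail condition with equality. None of
    \<open>c\<close>, \<open>K\<close> and \<open>s\<close> involves \<open>n\<close>, so the gap
    \<open>b * s^2 / 2\<close> survives the limit.\<close>
  define K where "K = max 1 (2 * (\<beta> * \<bar>\<mu>\<bar> + c + 1) / (\<beta> * (a - b)))"
  define s where "s = (2 * pi * \<beta>) powr (- real CARD('d) / 2) / 2 * exp (\<beta> * \<mu> - \<beta> * a * (K + 1))"
  have K: "1 \<le> K" "\<beta> * \<bar>\<mu>\<bar> + c + 1 \<le> \<beta> * (a - b) / 2 * K"
  proof -
    have "2 * (\<beta> * \<bar>\<mu>\<bar> + c + 1) / (\<beta> * (a - b)) \<le> K" by (simp add: K_def)
    then show "\<beta> * \<bar>\<mu>\<bar> + c + 1 \<le> \<beta> * (a - b) / 2 * K"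
      using assms(2,4) by (simp add: pos_divide_le_eq mult.commute)
  qed (simp add: K_def)
  have "eventually (\<lambda>n. finite_volume_pressure P a b q \<beta> \<mu> n + b * s\<^sup>2 / 2
      \<le> finite_volume_pressure P a b (\<lambda>_. 1) \<beta> \<mu> n) sequentially"
    using admissible_cutoff_eventually_ge[OF assms(5)] eventually_ge_at_top[of 1]
  proof eventually_elim
    case (elim n)
    show ?case
      using assms(1) by (intro finite_volume_pressure_gap[where P=P and q=q and n=n, OF _ assms(2-4,6,7) elim(2,1) c_def K s_def]) auto
  qed
  moreover have "(\<lambda>n. finite_volume_pressure P a b q \<beta> \<mu> n + b * s\<^sup>2 / 2) \<longlonglongrightarrow> pressure_HYL P a b q \<beta> \<mu> + b * s\<^sup>2 / 2"
    unfolding pressure_HYL_def using assms(8) by (intro tendsto_add tendsto_const) (simp add: convergent_LIMSEQ_iff)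
  moreover have "finite_volume_pressure P a b (\<lambda>_. 1) \<beta> \<mu> \<longlonglongrightarrow> pressure_HYL_full P a b \<beta> \<mu>"
    unfolding pressure_HYL_full_def using assms(9) by (simp add: convergent_LIMSEQ_iff)
  ultimately have "pressure_HYL P a b q \<beta> \<mu> + b * s\<^sup>2 / 2 \<le> pressure_HYL_full P a b \<beta> \<mu>"
    by (intro tendsto_le[OF sequentially_bot])
  moreover have "0 < b * s\<^sup>2 / 2" using assms(3,4) by (simp add: s_def)
  ultimately show ?thesis by linarith
qed

end
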